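(* Let $\eta$ be an $\mathrm{ATL}^{+}$ state formula (in negation normal form) and let $\mathcal{T}^{\eta}$ be the final tableau produced for $\eta$ by the tableau procedure described in the context. If $\mathcal{T}^{\eta}$ is open (some state of $\mathcal{T}^{\eta}$ contains $\eta$), then $\eta$ is satisfiable, i.e. there exist a concurrent game model $\mathcal{M}$ and a state $s$ with $\mathcal{M},s\models\eta$.
   Context: Agents and models. Fix a finite non-empty set of agents $\mathbb{A}=\{1,\dots,k\}$ and a set $\mathrm{Prop}$ of atomic propositions. A concurrent game model (CGM) is $\mathcal{M}=(\mathbb{A},\mathsf{St},\{\mathsf{Act}_a\}_{a},\{\mathsf{act}_a\}_{a},\mathsf{out},\mathrm{Prop},L)$ where $\mathsf{St}$ is a non-empty set of states, $\mathsf{act}_a(s)\subseteq\mathsf{Act}_a$ is the non-empty set of actions available to $a$ at $s$, $\mathsf{out}(s,\sigma)$ is the unique successor state of $s$ under an action profile $\sigma$ (one available action per agent), and $L:\mathsf{St}\to\mathcal{P}(\mathrm{Prop})$. For $A\subseteq\mathbb{A}$ an $A$-action at $s$ is a tuple of available actions of the agents in $A$. Plays are infinite sequences of states each obtained from the previous one by some action profile; histories are finite prefixes. A (perfect-recall) strategy of $A$ assigns to every history $h$ an $A$-action available at its last state; a play $\lambda$ is consistent with it if each step $\lambda_i\to\lambda_{i+1}$ is produced by an action profile extending the $A$-action prescribed for $\lambda_0\dots\lambda_i$. An $A$-co-strategy assigns to each history $h$ and each strategy $F_A$ of $A$ an action tuple of $\mathbb{A}\setminus A$ available at the last state of $h$;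 a play is consistent with a co-strategy $F^c$ if for some strategy $F_A$ of $A$ each step is produced by the profile combining $F_A(\lambda_{\le i})$ and $F^c(\lambda_{\le i},F_A)$. Syntax (negation normal form). State formulae: $\varphi::=l\mid\varphi\vee\varphi\mid\varphi\wedge\varphi\mid\langle\langle A\rangle\rangle\Phi\mid[[A]]\Phi$ with $l$ a literal ($p$ or $\neg p$, $p\in\mathrm{Prop}$) and $A\subseteq\mathbb{A}$; path formulae: $\Phi::=\varphi\mid\bigcirc\varphi\mid\Box\varphi\mid\varphi\,\mathcal{U}\,\varphi\mid\Phi\vee\Phi\mid\Phi\wedge\Phi$. $\top$ abbreviates $p\vee\neg p$, $\bot$ its negation. Semantics is standard: $\mathcal{M},s\models\langle\langle A\rangle\rangle\Phi$ iff some strategy of $A$ makes every consistent play from $s$ satisfy $\Phi$; $\mathcal{M},s\models[[A]]\Phi$ iff some $A$-co-strategy makes every consistent play from $s$ satisfy $\Phi$; a state formula holds on a play iff it holds at its first state; $\bigcirc,\Box,\mathcal{U}$, $\wedge$, $\vee$ on plays are as in LTL. Decomposition. For path formulae define $\mathsf{dec}(\Phi)$, a set of pairs (state formula, path formula): $\mathsf{dec}(\varphi)=\{\langle\varphi,\top\rangle\}$ for a state formula $\varphi$; $\mathsf{dec}(\bigcirc\varphi)=\{\langle\top,\varphi\rangle\}$; $\mathsf{dec}(\Box\varphi)=\{\langle\varphi,\Box\varphi\rangle\}$; $\mathsf{dec}(\varphi\,\mathcal{U}\,\psi)=\{\langle\varphi,\varphi\,\mathcal{U}\,\psi\rangle,\langle\psi,\top\rangle\}$;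 $\mathsf{dec}(\Phi_1\wedge\Phi_2)=\{\langle\psi_i\wedge\psi_j,\Psi_i\wedge\Psi_j\rangle:\langle\psi_i,\Psi_i\rangle\in\mathsf{dec}(\Phi_1),\langle\psi_j,\Psi_j\rangle\in\mathsf{dec}(\Phi_2)\}$; $\mathsf{dec}(\Phi_1\vee\Phi_2)=\mathsf{dec}(\Phi_1)\cup\mathsf{dec}(\Phi_2)\cup\{\langle\psi_i\wedge\psi_j,\Psi_i\vee\Psi_j\rangle:\langle\psi_i,\Psi_i\rangle\in\mathsf{dec}(\Phi_1),\langle\psi_j,\Psi_j\rangle\in\mathsf{dec}(\Phi_2),\Psi_i\neq\top\neq\Psi_j\}$. A $\gamma$-formula is one of the form $\langle\langle A\rangle\rangle\Phi$ or $[[A]]\Phi$ where the main operator of $\Phi$ is not $\bigcirc$; its $\gamma$-components are, for $\langle\psi,\Psi\rangle\in\mathsf{dec}(\Phi)$: $\psi$ if $\Psi=\top$, and otherwise $\psi\wedge\langle\langle A\rangle\rangle\bigcirc\langle\langle A\rangle\rangle\Psi$ (resp. $\psi\wedge[[A]]\bigcirc[[A]]\Psi$). Other components: $\varphi\wedge\psi$ has $\alpha$-components $\varphi,\psi$; $[[\mathbb{A}]]\bigcirc\psi$ has $\alpha$-component $\langle\langle\emptyset\rangle\rangle\bigcirc\psi$; $\varphi\vee\psi$ has $\beta$-components $\varphi,\psi$; $\langle\langle A\rangle\rangle\bigcirc\psi$ and $[[A]]\bigcirc\psi$ ($A\neq\mathbb{A}$) have successor component $\psi$ and are called primitive successor formulae.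 The closure $cl(\eta)$ is the least set containing $\eta,\top,\bot$ and closed under taking all these components. Full expansions. For a set $\Gamma$ of state formulae, a full expansion of $\Gamma$ is a set $\Delta$ with $\Gamma\subseteq\Delta\subseteq cl(\Gamma)$, not containing $\bot$ nor any pair $\varphi,\neg\varphi$, such that: $\varphi\wedge\psi\in\Delta$ implies $\varphi,\psi\in\Delta$; $\varphi\vee\psi\in\Delta$ implies $\varphi\in\Delta$ or $\psi\in\Delta$; every $\gamma$-formula $\xi\in\Delta$ has at least one $\gamma$-component in $\Delta$, and exactly one of them, denoted $\gamma(\xi,\Delta)$, is designated as linked to $\xi$. Tableau procedure for input $\eta$. Pretableau: nodes are prestates (sets of formulae) and states (full expansions), identified with their labels; start with the prestate $\{\eta\}$ and apply the two rules until saturation. (SR) For a prestate $\Gamma$ and each full expansion $\Delta$ of $\Gamma$: if $\Delta$ contains no formula of the form $\langle\langle A\rangle\rangle\bigcirc\varphi$ or $[[A]]\bigcirc\varphi$, add $\langle\langle\mathbb{A}\rangle\rangle\bigcirc\top$ to it; add the state $\Delta$ (or reuse an existing state with the same label) and an edge $\Gamma\Rightarrow\Delta$. (Next) For a state $\Delta$, list its primitive successor formulae as $\langle\langle A_0\rangle\rangle\bigcirc\varphi_0,\dots,\langle\langle A_{m-1}\rangle\rangle\bigcirc\varphi_{m-1},[[A'_0]]\bigcirc\psi_0,\dots,[[A'_{l-1}]]\bigcirc\psi_{l-1}$ (with $A'_q\neq\mathbb{A}$); let $r=m+l$ and $D(\Delta)=\{0,\dots,r-1\}^{\mathbb{A}}$.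 For $\sigma\in D(\Delta)$ let $N(\sigma)=\{a:\sigma_a\ge m\}$ and $\mathrm{co}(\sigma)=(\sum_{a\in N(\sigma)}(\sigma_a-m))\bmod l$. Create the prestate $\Gamma_\sigma=\{\varphi_p:\sigma_a=p\text{ for all }a\in A_p\}\cup\{\psi_q:\mathrm{co}(\sigma)=q,\ \mathbb{A}\setminus A'_q\subseteq N(\sigma)\}$ (adding $\top$ if it is empty, reusing an existing identical prestate) and an edge $\Delta\xrightarrow{\sigma}\Gamma_\sigma$. Initial tableau: delete all prestates, putting $\Delta\xrightarrow{\sigma}\Delta'$ whenever $\Delta\xrightarrow{\sigma}\Gamma\Rightarrow\Delta'$. Elimination: repeatedly delete one state $\Delta$ from the current tableau if (ER1) for some $\sigma\in D(\Delta)$ no remaining state $\Delta'$ has $\Delta\xrightarrow{\sigma}\Delta'$, or (ER2) $\Delta$ contains a potential eventuality (i.e. a $\gamma$-formula) not realized at $\Delta$ in the current tableau. Realization: define $Real(\Phi,\Theta)$ for a path formula $\Phi$ and a set $\Theta$ by $Real(\Phi\wedge\Psi)=Real(\Phi)\wedge Real(\Psi)$, $Real(\Phi\vee\Psi)=Real(\Phi)\vee Real(\Psi)$, $Real(\varphi,\Theta)$ iff $\varphi\in\Theta$ ($\varphi$ a state formula), $Real(\bigcirc\varphi,\Theta)=$ false, $Real(\Box\varphi,\Theta)$ iff $\varphi\in\Theta$, $Real(\varphi\,\mathcal{U}\,\psi,\Theta)$ iff $\psi\in\Theta$. Realization is defined inductively: $\xi=\langle\langle A\rangle\rangle\Phi$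 (resp. $[[A]]\Phi$) in $\Delta$ is realized at $\Delta$ if $Real(\Phi,\Delta)$ holds, or if $\gamma(\xi,\Delta)$ is $\psi\wedge\langle\langle A\rangle\rangle\bigcirc\xi'$ (resp. $\psi\wedge[[A]]\bigcirc\xi'$) and for every $\sigma\in D(\Delta)$ with $\sigma_a=p$ for all $a\in A$, where $\langle\langle A\rangle\rangle\bigcirc\xi'$ is the $p$-th listed formula (resp. every $\sigma$ with $\mathrm{co}(\sigma)=q$ and $\mathbb{A}\setminus A\subseteq N(\sigma)$, where $[[A]]\bigcirc\xi'$ is the $q$-th listed unavoidable formula), some remaining $\Delta'$ with $\Delta\xrightarrow{\sigma}\Delta'$ has $\xi'$ realized at $\Delta'$. When no elimination applies, the result is the final tableau; it is open if some of its states contains $\eta$, closed otherwise.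
   Formalization: Full expansions must also contain the α-component ⟨⟨∅⟩⟩○ψ of each [[𝔸]]○ψ (else the tableau for the unsatisfiable [[𝔸]]○⊥ is open), and [[𝔸]]Φ may be realized through that component along all σ. *)

theory Defs
  imports "HOL-Library.FuncSet"
begin

text \<open>
  The set of agents is the universe of a finite type \<open>'ag\<close>, and Prop is the universe of the type
  \<open>'p\<close>.
\<close>

section \<open>Syntax\<close>

datatype ('ag, 'p) sfm =
    Pos 'p
  | Neg 'p
  | Or "('ag, 'p) sfm" "('ag, 'p) sfm"
  | And "('ag, 'p) sfm" "('ag, 'p) sfm"
  | Can "'ag set" "('ag, 'p) pfm"      (* <<A>> *)
  | Unav "'ag set" "('ag, 'p) pfm"     (* [[A]] *)
and ('ag, 'p) pfm =
    PState "('ag, 'p) sfm"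
  | PNext "('ag, 'p) sfm"
  | PBox "('ag, 'p) sfm"
  | PUntil "('ag, 'p) sfm" "('ag, 'p) sfm"
  | POr "('ag, 'p) pfm" "('ag, 'p) pfm"
  | PAnd "('ag, 'p) pfm" "('ag, 'p) pfm"

text \<open>The atom \<open>p0\<close> is the one used in the abbreviation \<open>\<top>\<close>; it is a parameter throughout.\<close>

definition Top :: "'p \<Rightarrow> ('ag, 'p) sfm" where
  "Top p0 = Or (Pos p0) (Neg p0)"

definition Bot :: "'p \<Rightarrow> ('ag, 'p) sfm" where
  "Bot p0 = And (Neg p0) (Pos p0)"


section \<open>Concurrent game models and semantics\<close>

record ('ag, 's, 'act, 'p) cgm =
  St :: "'s set"
  Act :: "'ag \<Rightarrow> 'act set"
  act :: "'ag \<Rightarrow> 's \<Rightarrow> 'act set"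
  out :: "'s \<Rightarrow> ('ag \<Rightarrow> 'act) \<Rightarrow> 's"
  lab :: "'s \<Rightarrow> 'p set"

definition actions :: "('ag, 's, 'act, 'p) cgm \<Rightarrow> 'ag set \<Rightarrow> 's \<Rightarrow> ('ag \<Rightarrow> 'act) set" where
  "actions M A s = (\<Pi>\<^sub>E a\<in>A. act M a s)"

abbreviation profiles :: "('ag, 's, 'act, 'p) cgm \<Rightarrow> 's \<Rightarrow> ('ag \<Rightarrow> 'act) set" where
  "profiles M s \<equiv> actions M UNIV s"

definition is_cgm :: "('ag, 's, 'act, 'p) cgm \<Rightarrow> bool" where
  "is_cgm M \<longleftrightarrow>
     St M \<noteq> {} \<and>
     (\<forall>s\<in>St M. \<forall>a. act M a s \<noteq> {} \<and> act M a s \<subseteq> Act M a) \<and>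
     (\<forall>s\<in>St M. \<forall>\<sigma>\<in>profiles M s. out M s \<sigma> \<in> St M)"

definition plays :: "('ag, 's, 'act, 'p) cgm \<Rightarrow> (nat \<Rightarrow> 's) set" where
  "plays M = {l. \<forall>i. l i \<in> St M \<and> (\<exists>\<sigma>\<in>profiles M (l i). l (Suc i) = out M (l i) \<sigma>)}"

definition prefix_upto :: "(nat \<Rightarrow> 's) \<Rightarrow> nat \<Rightarrow> 's list" where
  "prefix_upto l i = map l [0..<Suc i]"

definition histories :: "('ag, 's, 'act, 'p) cgm \<Rightarrow> 's list set" where
  "histories M = {prefix_upto l i | l i. l \<in> plays M}"

type_synonym ('ag, 's, 'act) strategy = "'s list \<Rightarrow> 'ag \<Rightarrow> 'act"

text \<open>
  Strategies are extensional functions, so that a co-strategy, which takes a strategy as an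
  argument, cannot depend on values outside the histories or outside the coalition.
\<close>

definition strategies ::
    "('ag, 's, 'act, 'p) cgm \<Rightarrow> 'ag set \<Rightarrow> ('ag, 's, 'act) strategy set" where
  "strategies M A = (\<Pi>\<^sub>E h\<in>histories M. actions M A (last h))"

definition co_strategies ::
    "('ag, 's, 'act, 'p) cgm \<Rightarrow> 'ag set \<Rightarrow>
       ('s list \<Rightarrow> ('ag, 's, 'act) strategy \<Rightarrow> 'ag \<Rightarrow> 'act) set" where
  "co_strategies M A =
     (\<Pi>\<^sub>E h\<in>histories M. \<Pi>\<^sub>E F\<in>strategies M A. actions M (- A) (last h))"

definition consistent ::
    "('ag, 's, 'act, 'p) cgm \<Rightarrow> 'ag set \<Rightarrow> ('ag, 's, 'act) strategy \<Rightarrow> (nat \<Rightarrow> 's) \<Rightarrow> bool" where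
  "consistent M A F l \<longleftrightarrow>
     l \<in> plays M \<and>
     (\<forall>i. \<exists>\<sigma>\<in>profiles M (l i).
        (\<forall>a\<in>A. \<sigma> a = F (prefix_upto l i) a) \<and> l (Suc i) = out M (l i) \<sigma>)"

definition co_consistent ::
    "('ag, 's, 'act, 'p) cgm \<Rightarrow> 'ag set \<Rightarrow>
       ('s list \<Rightarrow> ('ag, 's, 'act) strategy \<Rightarrow> 'ag \<Rightarrow> 'act) \<Rightarrow> (nat \<Rightarrow> 's) \<Rightarrow> bool" where
  "co_consistent M A Fc l \<longleftrightarrow>
     l \<in> plays M \<and>
     (\<exists>F\<in>strategies M A. \<forall>i.
        l (Suc i) =
          out M (l i) (\<lambda>a. if a \<in> A then F (prefix_upto l i) a else Fc (prefix_upto l i) F a))"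

primrec
  sat :: "('ag, 's, 'act, 'p) cgm \<Rightarrow> ('ag, 'p) sfm \<Rightarrow> 's \<Rightarrow> bool" and
  psat :: "('ag, 's, 'act, 'p) cgm \<Rightarrow> ('ag, 'p) pfm \<Rightarrow> (nat \<Rightarrow> 's) \<Rightarrow> bool"
where
  "sat M (Pos p) = (\<lambda>s. p \<in> lab M s)"
| "sat M (Neg p) = (\<lambda>s. p \<notin> lab M s)"
| "sat M (Or \<phi> \<psi>) = (\<lambda>s. sat M \<phi> s \<or> sat M \<psi> s)"
| "sat M (And \<phi> \<psi>) = (\<lambda>s. sat M \<phi> s \<and> sat M \<psi> s)"
| "sat M (Can A \<Phi>) =
     (\<lambda>s. \<exists>F\<in>strategies M A. \<forall>l. l 0 = s \<and> consistent M A F l \<longrightarrow> psat M \<Phi> l)"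
| "sat M (Unav A \<Phi>) =
     (\<lambda>s. \<exists>Fc\<in>co_strategies M A. \<forall>l. l 0 = s \<and> co_consistent M A Fc l \<longrightarrow> psat M \<Phi> l)"
| "psat M (PState \<phi>) = (\<lambda>l. sat M \<phi> (l 0))"
| "psat M (PNext \<phi>) = (\<lambda>l. sat M \<phi> (l 1))"
| "psat M (PBox \<phi>) = (\<lambda>l. \<forall>i. sat M \<phi> (l i))"
| "psat M (PUntil \<phi> \<psi>) = (\<lambda>l. \<exists>i. sat M \<psi> (l i) \<and> (\<forall>j<i. sat M \<phi> (l j)))"
| "psat M (POr \<Phi> \<Psi>) = (\<lambda>l. psat M \<Phi> l \<or> psat M \<Psi> l)"
| "psat M (PAnd \<Phi> \<Psi>) = (\<lambda>l. psat M \<Phi> l \<and> psat M \<Psi> l)"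


section \<open>Decomposition, components and closure\<close>

fun dec :: "'p \<Rightarrow> ('ag, 'p) pfm \<Rightarrow> (('ag, 'p) sfm \<times> ('ag, 'p) pfm) set" where
  "dec p0 (PState \<phi>) = {(\<phi>, PState (Top p0))}"
| "dec p0 (PNext \<phi>) = {(Top p0, PState \<phi>)}"
| "dec p0 (PBox \<phi>) = {(\<phi>, PBox \<phi>)}"
| "dec p0 (PUntil \<phi> \<psi>) = {(\<phi>, PUntil \<phi> \<psi>), (\<psi>, PState (Top p0))}"
| "dec p0 (PAnd \<Phi>1 \<Phi>2) =
     {(And \<psi>1 \<psi>2, PAnd \<Psi>1 \<Psi>2) | \<psi>1 \<Psi>1 \<psi>2 \<Psi>2.
        (\<psi>1, \<Psi>1) \<in> dec p0 \<Phi>1 \<and> (\<psi>2, \<Psi>2) \<in> dec p0 \<Phi>2}"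
| "dec p0 (POr \<Phi>1 \<Phi>2) =
     dec p0 \<Phi>1 \<union> dec p0 \<Phi>2 \<union>
     {(And \<psi>1 \<psi>2, POr \<Psi>1 \<Psi>2) | \<psi>1 \<Psi>1 \<psi>2 \<Psi>2.
        (\<psi>1, \<Psi>1) \<in> dec p0 \<Phi>1 \<and> (\<psi>2, \<Psi>2) \<in> dec p0 \<Phi>2 \<and>
        \<Psi>1 \<noteq> PState (Top p0) \<and> \<Psi>2 \<noteq> PState (Top p0)}"

fun is_gamma :: "('ag, 'p) sfm \<Rightarrow> bool" where
  "is_gamma (Can A \<Phi>) \<longleftrightarrow> (\<nexists>\<phi>. \<Phi> = PNext \<phi>)"
| "is_gamma (Unav A \<Phi>) \<longleftrightarrow> (\<nexists>\<phi>. \<Phi> = PNext \<phi>)"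
| "is_gamma _ \<longleftrightarrow> False"

text \<open>The components of \<open>Q\<Phi>\<close> for a strategic operator \<open>Q\<close>, i.e. \<open>Can A\<close> or \<open>Unav A\<close>.\<close>

definition dec_comps ::
    "'p \<Rightarrow> (('ag, 'p) pfm \<Rightarrow> ('ag, 'p) sfm) \<Rightarrow> ('ag, 'p) pfm \<Rightarrow> ('ag, 'p) sfm set" where
  "dec_comps p0 Q \<Phi> =
     {if \<Psi> = PState (Top p0) then \<psi> else And \<psi> (Q (PNext (Q \<Psi>))) | \<psi> \<Psi>. (\<psi>, \<Psi>) \<in> dec p0 \<Phi>}"

fun gamma_comps :: "'p \<Rightarrow> ('ag, 'p) sfm \<Rightarrow> ('ag, 'p) sfm set" where
  "gamma_comps p0 (Can A \<Phi>) = (if is_gamma (Can A \<Phi>) then dec_comps p0 (Can A) \<Phi> else {})"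
| "gamma_comps p0 (Unav A \<Phi>) = (if is_gamma (Unav A \<Phi>) then dec_comps p0 (Unav A) \<Phi> else {})"
| "gamma_comps p0 _ = {}"

fun alpha_comps :: "('ag, 'p) sfm \<Rightarrow> ('ag, 'p) sfm set" where
  "alpha_comps (And \<phi> \<psi>) = {\<phi>, \<psi>}"
| "alpha_comps (Unav A (PNext \<psi>)) = (if A = UNIV then {Can {} (PNext \<psi>)} else {})"
| "alpha_comps _ = {}"

fun beta_comps :: "('ag, 'p) sfm \<Rightarrow> ('ag, 'p) sfm set" where
  "beta_comps (Or \<phi> \<psi>) = {\<phi>, \<psi>}"
| "beta_comps _ = {}"

fun succ_comps :: "('ag, 'p) sfm \<Rightarrow> ('ag, 'p) sfm set" where
  "succ_comps (Can A (PNext \<psi>)) = {\<psi>}"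
| "succ_comps (Unav A (PNext \<psi>)) = (if A \<noteq> UNIV then {\<psi>} else {})"
| "succ_comps _ = {}"

inductive_set cl :: "'p \<Rightarrow> ('ag, 'p) sfm set \<Rightarrow> ('ag, 'p) sfm set"
  for p0 :: 'p and G :: "('ag, 'p) sfm set"
where
  base: "\<phi> \<in> G \<Longrightarrow> \<phi> \<in> cl p0 G"
| top: "Top p0 \<in> cl p0 G"
| bot: "Bot p0 \<in> cl p0 G"
| comp: "\<phi> \<in> cl p0 G \<Longrightarrow>
    \<psi> \<in> alpha_comps \<phi> \<union> beta_comps \<phi> \<union> gamma_comps p0 \<phi> \<union> succ_comps \<phi> \<Longrightarrow> \<psi> \<in> cl p0 G"


section \<open>Pretableau and initial tableau\<close>

text \<open>
  The links are part of a full expansion: a state is a pair of a set of formulae and a partial map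
  that sends each \<open>\<gamma>\<close>-formula of the set to the \<open>\<gamma>\<close>-component linked to it. Hence expansions with
  the same formulae and different links are different states.
\<close>

type_synonym ('ag, 'p) tstate =
  "('ag, 'p) sfm set \<times> (('ag, 'p) sfm \<Rightarrow> ('ag, 'p) sfm option)"

text \<open>
  The \<open>\<alpha>\<close>-condition covers both kinds of \<open>\<alpha>\<close>-formulae, conjunctions and \<open>Unav UNIV (PNext \<psi>)\<close>.
  The latter are not among the primitive successor formulae, so they constrain the successors of a
  state only through their \<open>\<alpha>\<close>-component.
\<close>

definition full_expansion :: "'p \<Rightarrow> ('ag, 'p) sfm set \<Rightarrow> ('ag, 'p) tstate \<Rightarrow> bool" where
  "full_expansion p0 G D \<longleftrightarrow>
     G \<subseteq> fst D \<and> fst D \<subseteq> cl p0 G \<and>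
     Bot p0 \<notin> fst D \<and>
     (\<forall>p. \<not> (Pos p \<in> fst D \<and> Neg p \<in> fst D)) \<and>
     (\<forall>\<phi>\<in>fst D. alpha_comps \<phi> \<subseteq> fst D) \<and>
     (\<forall>\<phi> \<psi>. Or \<phi> \<psi> \<in> fst D \<longrightarrow> \<phi> \<in> fst D \<or> \<psi> \<in> fst D) \<and>
     dom (snd D) = {\<xi> \<in> fst D. is_gamma \<xi>} \<and>
     (\<forall>\<xi> \<chi>. snd D \<xi> = Some \<chi> \<longrightarrow> \<chi> \<in> gamma_comps p0 \<xi> \<and> \<chi> \<in> fst D)"

definition has_next :: "('ag, 'p) sfm set \<Rightarrow> bool" where
  "has_next X \<longleftrightarrow> (\<exists>A \<phi>. Can A (PNext \<phi>) \<in> X \<or> Unav A (PNext \<phi>) \<in> X)"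

definition add_next :: "'p \<Rightarrow> ('ag, 'p) tstate \<Rightarrow> ('ag, 'p) tstate" where
  "add_next p0 D =
     (if has_next (fst D) then D else (insert (Can UNIV (PNext (Top p0))) (fst D), snd D))"

definition SR :: "'p \<Rightarrow> ('ag, 'p) sfm set \<Rightarrow> ('ag, 'p) tstate set" where
  "SR p0 G = {add_next p0 D | D. full_expansion p0 G D}"

text \<open>
  The order in which the primitive successor formulae of a state are listed is an arbitrary choice
  of the procedure. It is given by two functions \<open>cs\<close> and \<open>us\<close>: the entry \<open>(A, \<phi>)\<close> of \<open>cs D\<close> stands
  for \<open>Can A (PNext \<phi>)\<close> and the entry \<open>(A, \<psi>)\<close> of \<open>us D\<close> for \<open>Unav A (PNext \<psi>)\<close>.
\<close>

type_synonym ('ag, 'p) listing = "('ag, 'p) tstate \<Rightarrow> ('ag set \<times> ('ag, 'p) sfm) list"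

definition is_listing :: "('ag, 'p) listing \<Rightarrow> ('ag, 'p) listing \<Rightarrow> bool" where
  "is_listing cs us \<longleftrightarrow>
     (\<forall>D. finite (fst D) \<longrightarrow>
        distinct (cs D) \<and> set (cs D) = {(A, \<phi>). Can A (PNext \<phi>) \<in> fst D} \<and>
        distinct (us D) \<and> set (us D) = {(A, \<psi>). Unav A (PNext \<psi>) \<in> fst D \<and> A \<noteq> UNIV})"

definition moves ::
    "('ag, 'p) listing \<Rightarrow> ('ag, 'p) listing \<Rightarrow> ('ag, 'p) tstate \<Rightarrow> ('ag \<Rightarrow> nat) set" where
  "moves cs us D = {\<sigma>. \<forall>a. \<sigma> a < length (cs D) + length (us D)}"

definition Nset :: "('ag, 'p) listing \<Rightarrow> ('ag, 'p) tstate \<Rightarrow> ('ag \<Rightarrow> nat) \<Rightarrow> 'ag set" where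
  "Nset cs D \<sigma> = {a. \<sigma> a \<ge> length (cs D)}"

definition co ::
    "('ag, 'p) listing \<Rightarrow> ('ag, 'p) listing \<Rightarrow> ('ag, 'p) tstate \<Rightarrow> ('ag \<Rightarrow> nat) \<Rightarrow> nat" where
  "co cs us D \<sigma> = (\<Sum>a\<in>Nset cs D \<sigma>. \<sigma> a - length (cs D)) mod length (us D)"

text \<open>
  The moves that trigger the \<open>p\<close>-th formula \<open>Can A (PNext \<phi>)\<close>, respectively the \<open>q\<close>-th formula
  \<open>Unav A (PNext \<psi>)\<close>, of the listing.
\<close>

definition can_moves ::
    "('ag, 'p) listing \<Rightarrow> ('ag, 'p) listing \<Rightarrow> ('ag, 'p) tstate \<Rightarrow> nat \<Rightarrow> 'ag set \<Rightarrow>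
       ('ag \<Rightarrow> nat) set" where
  "can_moves cs us D p A = {\<sigma> \<in> moves cs us D. \<forall>a\<in>A. \<sigma> a = p}"

definition unav_moves ::
    "('ag, 'p) listing \<Rightarrow> ('ag, 'p) listing \<Rightarrow> ('ag, 'p) tstate \<Rightarrow> nat \<Rightarrow> 'ag set \<Rightarrow>
       ('ag \<Rightarrow> nat) set" where
  "unav_moves cs us D q A = {\<sigma> \<in> moves cs us D. co cs us D \<sigma> = q \<and> - A \<subseteq> Nset cs D \<sigma>}"

definition next_prestate ::
    "'p \<Rightarrow> ('ag, 'p) listing \<Rightarrow> ('ag, 'p) listing \<Rightarrow> ('ag, 'p) tstate \<Rightarrow> ('ag \<Rightarrow> nat) \<Rightarrow>
       ('ag, 'p) sfm set" where
  "next_prestate p0 cs us D \<sigma> =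
     (let G = {\<phi>. \<exists>p A. p < length (cs D) \<and> cs D ! p = (A, \<phi>) \<and> \<sigma> \<in> can_moves cs us D p A} \<union>
              {\<psi>. \<exists>q A. q < length (us D) \<and> us D ! q = (A, \<psi>) \<and> \<sigma> \<in> unav_moves cs us D q A}
      in if G = {} then {Top p0} else G)"

inductive
  prestate :: "'p \<Rightarrow> ('ag, 'p) listing \<Rightarrow> ('ag, 'p) listing \<Rightarrow> ('ag, 'p) sfm \<Rightarrow>
    ('ag, 'p) sfm set \<Rightarrow> bool" and
  tab_state :: "'p \<Rightarrow> ('ag, 'p) listing \<Rightarrow> ('ag, 'p) listing \<Rightarrow> ('ag, 'p) sfm \<Rightarrow>
    ('ag, 'p) tstate \<Rightarrow> bool"
  for p0 :: 'p and cs us :: "('ag, 'p) listing" and \<eta> :: "('ag, 'p) sfm"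
where
  start: "prestate p0 cs us \<eta> {\<eta>}"
| SR: "prestate p0 cs us \<eta> G \<Longrightarrow> D \<in> SR p0 G \<Longrightarrow> tab_state p0 cs us \<eta> D"
| Next: "tab_state p0 cs us \<eta> D \<Longrightarrow> \<sigma> \<in> moves cs us D \<Longrightarrow>
    prestate p0 cs us \<eta> (next_prestate p0 cs us D \<sigma>)"

definition initial_tableau ::
    "'p \<Rightarrow> ('ag, 'p) listing \<Rightarrow> ('ag, 'p) listing \<Rightarrow> ('ag, 'p) sfm \<Rightarrow> ('ag, 'p) tstate set" where
  "initial_tableau p0 cs us \<eta> = {D. tab_state p0 cs us \<eta> D}"

text \<open>A tableau is represented by its set \<open>T\<close> of remaining states; \<open>edge\<close> is its labelled edge relation.\<close>

definition edge ::
    "'p \<Rightarrow> ('ag, 'p) listing \<Rightarrow> ('ag, 'p) listing \<Rightarrow> ('ag, 'p) tstate set \<Rightarrow>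
       ('ag, 'p) tstate \<Rightarrow> ('ag \<Rightarrow> nat) \<Rightarrow> ('ag, 'p) tstate \<Rightarrow> bool" where
  "edge p0 cs us T D \<sigma> D' \<longleftrightarrow>
     D \<in> T \<and> D' \<in> T \<and> \<sigma> \<in> moves cs us D \<and> D' \<in> SR p0 (next_prestate p0 cs us D \<sigma>)"


section \<open>Realization and elimination\<close>

fun Real :: "('ag, 'p) pfm \<Rightarrow> ('ag, 'p) sfm set \<Rightarrow> bool" where
  "Real (PAnd \<Phi> \<Psi>) X \<longleftrightarrow> Real \<Phi> X \<and> Real \<Psi> X"
| "Real (POr \<Phi> \<Psi>) X \<longleftrightarrow> Real \<Phi> X \<or> Real \<Psi> X"
| "Real (PState \<phi>) X \<longleftrightarrow> \<phi> \<in> X"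
| "Real (PNext \<phi>) X \<longleftrightarrow> False"
| "Real (PBox \<phi>) X \<longleftrightarrow> \<phi> \<in> X"
| "Real (PUntil \<phi> \<psi>) X \<longleftrightarrow> \<psi> \<in> X"

text \<open>
  A formula \<open>Unav UNIV (PNext \<xi>')\<close> is never listed itself; its \<open>\<alpha>\<close>-component \<open>Can {} (PNext \<xi>')\<close> is,
  and all moves trigger it. This accounts for the separate rule \<open>unav_all_step\<close>.
\<close>

inductive realized ::
    "'p \<Rightarrow> ('ag, 'p) listing \<Rightarrow> ('ag, 'p) listing \<Rightarrow> ('ag, 'p) tstate set \<Rightarrow>
       ('ag, 'p) sfm \<Rightarrow> ('ag, 'p) tstate \<Rightarrow> bool"
  for p0 :: 'p and cs us :: "('ag, 'p) listing" and T :: "('ag, 'p) tstate set"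
where
  can_now: "D \<in> T \<Longrightarrow> Can A \<Phi> \<in> fst D \<Longrightarrow> Real \<Phi> (fst D) \<Longrightarrow>
    realized p0 cs us T (Can A \<Phi>) D"
| unav_now: "D \<in> T \<Longrightarrow> Unav A \<Phi> \<in> fst D \<Longrightarrow> Real \<Phi> (fst D) \<Longrightarrow>
    realized p0 cs us T (Unav A \<Phi>) D"
| can_step: "D \<in> T \<Longrightarrow> Can A \<Phi> \<in> fst D \<Longrightarrow>
    snd D (Can A \<Phi>) = Some (And \<psi> (Can A (PNext \<xi>'))) \<Longrightarrow>
    p < length (cs D) \<Longrightarrow> cs D ! p = (A, \<xi>') \<Longrightarrow>
    (\<forall>\<sigma>\<in>can_moves cs us D p A. \<exists>D'. edge p0 cs us T D \<sigma> D' \<and> realized p0 cs us T \<xi>' D') \<Longrightarrow>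
    realized p0 cs us T (Can A \<Phi>) D"
| unav_step: "D \<in> T \<Longrightarrow> Unav A \<Phi> \<in> fst D \<Longrightarrow>
    snd D (Unav A \<Phi>) = Some (And \<psi> (Unav A (PNext \<xi>'))) \<Longrightarrow>
    q < length (us D) \<Longrightarrow> us D ! q = (A, \<xi>') \<Longrightarrow>
    (\<forall>\<sigma>\<in>unav_moves cs us D q A. \<exists>D'. edge p0 cs us T D \<sigma> D' \<and> realized p0 cs us T \<xi>' D') \<Longrightarrow>
    realized p0 cs us T (Unav A \<Phi>) D"
| unav_all_step: "D \<in> T \<Longrightarrow> Unav UNIV \<Phi> \<in> fst D \<Longrightarrow>
    snd D (Unav UNIV \<Phi>) = Some (And \<psi> (Unav UNIV (PNext \<xi>'))) \<Longrightarrow>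
    p < length (cs D) \<Longrightarrow> cs D ! p = ({}, \<xi>') \<Longrightarrow>
    (\<forall>\<sigma>\<in>can_moves cs us D p {}. \<exists>D'. edge p0 cs us T D \<sigma> D' \<and> realized p0 cs us T \<xi>' D') \<Longrightarrow>
    realized p0 cs us T (Unav UNIV \<Phi>) D"

definition ER1 ::
    "'p \<Rightarrow> ('ag, 'p) listing \<Rightarrow> ('ag, 'p) listing \<Rightarrow> ('ag, 'p) tstate set \<Rightarrow>
       ('ag, 'p) tstate \<Rightarrow> bool" where
  "ER1 p0 cs us T D \<longleftrightarrow> (\<exists>\<sigma>\<in>moves cs us D. \<nexists>D'. edge p0 cs us T D \<sigma> D')"

definition ER2 ::
    "'p \<Rightarrow> ('ag, 'p) listing \<Rightarrow> ('ag, 'p) listing \<Rightarrow> ('ag, 'p) tstate set \<Rightarrow>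
       ('ag, 'p) tstate \<Rightarrow> bool" where
  "ER2 p0 cs us T D \<longleftrightarrow> (\<exists>\<xi>\<in>fst D. is_gamma \<xi> \<and> \<not> realized p0 cs us T \<xi> D)"

definition eliminate ::
    "'p \<Rightarrow> ('ag, 'p) listing \<Rightarrow> ('ag, 'p) listing \<Rightarrow> ('ag, 'p) tstate set \<Rightarrow>
       ('ag, 'p) tstate set \<Rightarrow> bool" where
  "eliminate p0 cs us T T' \<longleftrightarrow>
     (\<exists>D\<in>T. (ER1 p0 cs us T D \<or> ER2 p0 cs us T D) \<and> T' = T - {D})"

definition final_tableau ::
    "'p \<Rightarrow> ('ag, 'p) listing \<Rightarrow> ('ag, 'p) listing \<Rightarrow> ('ag, 'p) sfm \<Rightarrow>
       ('ag, 'p) tstate set \<Rightarrow> bool" where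
  "final_tableau p0 cs us \<eta> T \<longleftrightarrow>
     (eliminate p0 cs us)\<^sup>*\<^sup>* (initial_tableau p0 cs us \<eta>) T \<and> (\<nexists>T'. eliminate p0 cs us T T')"

definition open_tableau :: "('ag, 'p) sfm \<Rightarrow> ('ag, 'p) tstate set \<Rightarrow> bool" where
  "open_tableau \<eta> T \<longleftrightarrow> (\<exists>D\<in>T. \<eta> \<in> fst D)"

end

theory Submission
  imports Defs "HOL-Library.Countable"
begin

text \<open>
  The model is the tree of all finite sequences of moves, unravelled from a state of the final
  tableau that contains \<open>\<eta>\<close>. Each node carries a tableau state and a counter selecting, in a fair
  enumeration, the eventuality in focus; among the tableau successors for a move, one that lowers
  the realization rank of this eventuality is preferred. In a node, a coalition with a
  \<open>\<gamma>\<close>-formula \<open>Q \<Phi>\<close> follows the links, which produces a thread of path formulas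
  \<open>\<Phi> = \<Phi>\<^sub>0, \<Phi>\<^sub>1, \<dots>\<close> with each \<open>\<Phi>\<^sub>i\<^sub>+\<^sub>1\<close> from the decomposition of \<open>\<Phi>\<^sub>i\<close>. A thread reaches
  \<open>\<top>\<close> or becomes constant. In the latter case the constant formula comes into focus at some point
  and stays there until \<open>Real\<close> holds, and for a constant thread one such moment makes the formula
  true on the play. Truth is then carried back along the thread by the decomposition.
\<close>

section \<open>Finiteness of the closure\<close>

definition comps :: "'p \<Rightarrow> ('ag, 'p) sfm \<Rightarrow> ('ag, 'p) sfm set" where
  "comps p0 \<phi> = alpha_comps \<phi> \<union> beta_comps \<phi> \<union> gamma_comps p0 \<phi> \<union> succ_comps \<phi>"

definition comp_closed :: "'p \<Rightarrow> ('ag, 'p) sfm set \<Rightarrow> bool" where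
  "comp_closed p0 S \<longleftrightarrow> (\<forall>\<phi>\<in>S. comps p0 \<phi> \<subseteq> S)"

text \<open>Every state formula that iterated \<open>dec\<close> yields is built by conjunction from
  these and \<open>Top p0\<close>. They are proper subformulae of \<open>Q \<Phi>\<close>, so a
  structural induction reaches them.\<close>

fun state_parts :: "('ag, 'p) pfm \<Rightarrow> ('ag, 'p) sfm set" where
  "state_parts (PState \<phi>) = {\<phi>}"
| "state_parts (PNext \<phi>) = {\<phi>}"
| "state_parts (PBox \<phi>) = {\<phi>}"
| "state_parts (PUntil \<phi> \<psi>) = {\<phi>, \<psi>}"
| "state_parts (POr \<Phi> \<Psi>) = state_parts \<Phi> \<union> state_parts \<Psi>"
| "state_parts (PAnd \<Phi> \<Psi>) = state_parts \<Phi> \<union> state_parts \<Psi>"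

text \<open>The datatype is mutually recursive; this rule inducts on the path connectives only and
  leaves state formulae opaque.\<close>

lemma pfm_induct [case_names PState PNext PBox PUntil POr PAnd]:
  assumes "\<And>\<phi>. P (PState \<phi>)" "\<And>\<phi>. P (PNext \<phi>)" "\<And>\<phi>. P (PBox \<phi>)" "\<And>\<phi> \<psi>. P (PUntil \<phi> \<psi>)"
    and "\<And>\<Phi> \<Psi>. P \<Phi> \<Longrightarrow> P \<Psi> \<Longrightarrow> P (POr \<Phi> \<Psi>)" "\<And>\<Phi> \<Psi>. P \<Phi> \<Longrightarrow> P \<Psi> \<Longrightarrow> P (PAnd \<Phi> \<Psi>)"
  shows "P \<Phi>"
  using assms by (induction \<Phi> rule: state_parts.induct) auto

text \<open>Both strategic operators behave alike under decomposition, so they are treated together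
  through a variable \<open>Q\<close>.\<close>

definition strat_op :: "(('ag, 'p) pfm \<Rightarrow> ('ag, 'p) sfm) \<Rightarrow> bool" where
  "strat_op Q \<longleftrightarrow> (\<exists>A. Q = Can A \<or> Q = Unav A)"

lemma strat_op_simps [simp]: "strat_op (Can A)" "strat_op (Unav A)"
  by (auto simp: strat_op_def)

lemma strat_op_cases:
  assumes "strat_op Q"
  obtains A where "Q = Can A" | A where "Q = Unav A"
  using assms by (auto simp: strat_op_def)

lemma is_gamma_strat_op: "strat_op Q \<Longrightarrow> is_gamma (Q \<Phi>) \<longleftrightarrow> (\<nexists>\<phi>. \<Phi> = PNext \<phi>)"
  by (auto simp: strat_op_def)

lemma gamma_comps_strat_op: "strat_op Q \<Longrightarrow> is_gamma (Q \<Phi>) \<Longrightarrow> gamma_comps p0 (Q \<Phi>) = dec_comps p0 Q \<Phi>"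
  by (auto simp: strat_op_def)

lemma comp_closed_Un: "comp_closed p0 S \<Longrightarrow> comp_closed p0 S' \<Longrightarrow> comp_closed p0 (S \<union> S')"
  by (auto simp: comp_closed_def)

lemma comp_closed_UN: "(\<And>x. x \<in> X \<Longrightarrow> comp_closed p0 (S x)) \<Longrightarrow> comp_closed p0 (\<Union>x\<in>X. S x)"
  unfolding comp_closed_def by blast

lemma comp_closed_Top: "comp_closed p0 {Top p0, Pos p0, Neg p0}"
  by (auto simp: comp_closed_def comps_def Top_def)

lemma comp_closed_Bot: "comp_closed p0 {Bot p0, Pos p0, Neg p0}"
  by (auto simp: comp_closed_def comps_def Bot_def)

text \<open>One layer of conjunctions creates no further obligations, since the components of a
  conjunction are its conjuncts.\<close>

lemma comp_closed_Ands:
  assumes "comp_closed p0 S"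
  shows "comp_closed p0 (S \<union> (\<lambda>(\<phi>, \<psi>). And \<phi> \<psi>) ` (S \<times> S))"
  using assms by (auto simp: comp_closed_def comps_def)

lemma pair_image_iff [simp]:
  "And \<phi> \<psi> \<in> (\<lambda>(\<phi>, \<psi>). And \<phi> \<psi>) ` (X \<times> Y) \<longleftrightarrow> \<phi> \<in> X \<and> \<psi> \<in> Y"
  "PAnd \<Phi> \<Psi> \<in> (\<lambda>(\<Phi>, \<Psi>). PAnd \<Phi> \<Psi>) ` (I \<times> J) \<longleftrightarrow> \<Phi> \<in> I \<and> \<Psi> \<in> J"
  "POr \<Phi> \<Psi> \<in> (\<lambda>(\<Phi>, \<Psi>). POr \<Phi> \<Psi>) ` (I \<times> J) \<longleftrightarrow> \<Phi> \<in> I \<and> \<Psi> \<in> J"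
  by auto

text \<open>Each Boolean connective of \<Phi> conjoins state formulae produced by its two sides, so
  it costs one more layer of conjunctions.\<close>

lemma dec_fst_closed:
  assumes "finite S" "comp_closed p0 S" "insert (Top p0) (state_parts \<Phi>) \<subseteq> S"
  shows "\<exists>S'. finite S' \<and> comp_closed p0 S' \<and> S \<subseteq> S' \<and> fst ` dec p0 \<Phi> \<subseteq> S'"
  using assms
proof (induction \<Phi> rule: pfm_induct)
  case (POr \<Phi>1 \<Phi>2)
  then obtain S1 S2 where S: "finite S1" "comp_closed p0 S1" "S \<subseteq> S1" "fst ` dec p0 \<Phi>1 \<subseteq> S1"
    "finite S2" "comp_closed p0 S2" "S \<subseteq> S2" "fst ` dec p0 \<Phi>2 \<subseteq> S2" by auto
  let ?S = "S1 \<union> S2"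
  have "\<psi> \<in> S1" if "(\<psi>, \<Psi>) \<in> dec p0 \<Phi>1" for \<psi> \<Psi> using S(4) that by force
  moreover have "\<psi> \<in> S2" if "(\<psi>, \<Psi>) \<in> dec p0 \<Phi>2" for \<psi> \<Psi> using S(8) that by force
  ultimately have "fst ` dec p0 (POr \<Phi>1 \<Phi>2) \<subseteq> ?S \<union> (\<lambda>(\<phi>, \<psi>). And \<phi> \<psi>) ` (?S \<times> ?S)"
    by auto
  then show ?case
    using S comp_closed_Ands[OF comp_closed_Un[OF S(2,6)]]
    by (intro exI[of _ "?S \<union> (\<lambda>(\<phi>, \<psi>). And \<phi> \<psi>) ` (?S \<times> ?S)"]) auto
next
  case (PAnd \<Phi>1 \<Phi>2)
  then obtain S1 S2 where S: "finite S1" "comp_closed p0 S1" "S \<subseteq> S1" "fst ` dec p0 \<Phi>1 \<subseteq> S1"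
    "finite S2" "comp_closed p0 S2" "S \<subseteq> S2" "fst ` dec p0 \<Phi>2 \<subseteq> S2" by auto
  let ?S = "S1 \<union> S2"
  have "\<psi> \<in> S1" if "(\<psi>, \<Psi>) \<in> dec p0 \<Phi>1" for \<psi> \<Psi> using S(4) that by force
  moreover have "\<psi> \<in> S2" if "(\<psi>, \<Psi>) \<in> dec p0 \<Phi>2" for \<psi> \<Psi> using S(8) that by force
  ultimately have "fst ` dec p0 (PAnd \<Phi>1 \<Phi>2) \<subseteq> ?S \<union> (\<lambda>(\<phi>, \<psi>). And \<phi> \<psi>) ` (?S \<times> ?S)"
    by auto
  then show ?case
    using S comp_closed_Ands[OF comp_closed_Un[OF S(2,6)]]
    by (intro exI[of _ "?S \<union> (\<lambda>(\<phi>, \<psi>). And \<phi> \<psi>) ` (?S \<times> ?S)"]) auto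
qed auto

lemma dec_state_parts:
  "(\<psi>, \<Psi>) \<in> dec p0 \<Phi> \<Longrightarrow> state_parts \<Psi> \<subseteq> insert (Top p0) (state_parts \<Phi>)"
  by (induction \<Phi> arbitrary: \<psi> \<Psi> rule: pfm_induct) (auto; blast)+

text \<open>A continuation of a Boolean combination pairs continuations of its arguments, so finite
  sets for the arguments give one for the combination. The bound on state parts prepares the use of
  \<open>dec_fst_closed\<close>.\<close>

lemma dec_snd_closed:
  "\<exists>I. finite I \<and> \<Phi> \<in> I \<and> (\<forall>\<Psi>\<in>I. snd ` dec p0 \<Psi> \<subseteq> I) \<and>
       (\<forall>\<Psi>\<in>I. state_parts \<Psi> \<subseteq> insert (Top p0) (state_parts \<Phi>))"
proof (induction \<Phi> rule: pfm_induct)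
  case (PState \<phi>)
  then show ?case by (intro exI[of _ "{PState \<phi>, PState (Top p0)}"]) auto
next
  case (PNext \<phi>)
  then show ?case by (intro exI[of _ "{PNext \<phi>, PState \<phi>, PState (Top p0)}"]) auto
next
  case (PBox \<phi>)
  then show ?case by (intro exI[of _ "{PBox \<phi>}"]) auto
next
  case (PUntil \<phi> \<psi>)
  then show ?case by (intro exI[of _ "{PUntil \<phi> \<psi>, PState (Top p0)}"]) auto
next
  case (POr \<Phi>1 \<Phi>2)
  then obtain I1 I2 where
    "finite I1" "\<Phi>1 \<in> I1" "\<forall>\<Psi>\<in>I1. snd ` dec p0 \<Psi> \<subseteq> I1"
    "\<forall>\<Psi>\<in>I1. state_parts \<Psi> \<subseteq> insert (Top p0) (state_parts \<Phi>1)"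
    "finite I2" "\<Phi>2 \<in> I2" "\<forall>\<Psi>\<in>I2. snd ` dec p0 \<Psi> \<subseteq> I2"
    "\<forall>\<Psi>\<in>I2. state_parts \<Psi> \<subseteq> insert (Top p0) (state_parts \<Phi>2)" by auto
  note I = this
  \<comment> \<open>A disjunction may continue as one disjunct alone, hence \<open>I1\<close> and
    \<open>I2\<close> besides the pairs.\<close>
  let ?I = "I1 \<union> I2 \<union> (\<lambda>(a, b). POr a b) ` (I1 \<times> I2)"
  have "\<Psi>' \<in> I1" if "\<Psi> \<in> I1" "(\<psi>, \<Psi>') \<in> dec p0 \<Psi>" for \<psi> \<Psi> \<Psi>' using I(3) that by force
  moreover have "\<Psi>' \<in> I2" if "\<Psi> \<in> I2" "(\<psi>, \<Psi>') \<in> dec p0 \<Psi>" for \<psi> \<Psi> \<Psi>' using I(7) that by force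
  ultimately have step: "\<Psi>' \<in> ?I" if "a \<in> I1" "b \<in> I2" "(\<psi>, \<Psi>') \<in> dec p0 (POr a b)" for a b \<psi> \<Psi>'
    using that(3) unfolding dec.simps by (elim UnE CollectE exE conjE) (use that(1,2) in \<open>auto\<close>)
  have "\<forall>\<Psi>\<in>?I. snd ` dec p0 \<Psi> \<subseteq> ?I"
  proof (intro ballI)
    fix \<Psi> assume "\<Psi> \<in> ?I"
    then consider "\<Psi> \<in> I1" | "\<Psi> \<in> I2" | a b where "a \<in> I1" "b \<in> I2" "\<Psi> = POr a b" by auto
    then show "snd ` dec p0 \<Psi> \<subseteq> ?I"
    proof cases
      case 3
      show ?thesis
        unfolding 3(3) using step[OF 3(1,2), of "fst x" "snd x" for x]
        by (intro image_subsetI) (simp only: prod.collapse)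
    qed (use I(3,7) in blast)+
  qed
  moreover have "\<forall>\<Psi>\<in>?I. state_parts \<Psi> \<subseteq> insert (Top p0) (state_parts (POr \<Phi>1 \<Phi>2))"
    using I(4,8) by (auto; blast)
  moreover have "finite ?I" "POr \<Phi>1 \<Phi>2 \<in> ?I" using I(1,2,5,6) by auto
  ultimately show ?case by (intro exI[of _ ?I] conjI)
next
  case (PAnd \<Phi>1 \<Phi>2)
  then obtain I1 I2 where
    "finite I1" "\<Phi>1 \<in> I1" "\<forall>\<Psi>\<in>I1. snd ` dec p0 \<Psi> \<subseteq> I1"
    "\<forall>\<Psi>\<in>I1. state_parts \<Psi> \<subseteq> insert (Top p0) (state_parts \<Phi>1)"
    "finite I2" "\<Phi>2 \<in> I2" "\<forall>\<Psi>\<in>I2. snd ` dec p0 \<Psi> \<subseteq> I2"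
    "\<forall>\<Psi>\<in>I2. state_parts \<Psi> \<subseteq> insert (Top p0) (state_parts \<Phi>2)" by auto
  note I = this
  let ?I = "(\<lambda>(a, b). PAnd a b) ` (I1 \<times> I2)"
  have "\<Psi>' \<in> I1" if "\<Psi> \<in> I1" "(\<psi>, \<Psi>') \<in> dec p0 \<Psi>" for \<psi> \<Psi> \<Psi>' using I(3) that by force
  moreover have "\<Psi>' \<in> I2" if "\<Psi> \<in> I2" "(\<psi>, \<Psi>') \<in> dec p0 \<Psi>" for \<psi> \<Psi> \<Psi>' using I(7) that by force
  ultimately have step: "\<Psi>' \<in> ?I" if "a \<in> I1" "b \<in> I2" "(\<psi>, \<Psi>') \<in> dec p0 (PAnd a b)" for a b \<psi> \<Psi>'
    using that(3) unfolding dec.simps by (elim UnE CollectE exE conjE) (use that(1,2) in \<open>auto\<close>)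
  have "\<forall>\<Psi>\<in>?I. snd ` dec p0 \<Psi> \<subseteq> ?I"
  proof (intro ballI)
    fix \<Psi> assume "\<Psi> \<in> ?I"
    then obtain a b where *: "a \<in> I1" "b \<in> I2" "\<Psi> = PAnd a b" by auto
    show "snd ` dec p0 \<Psi> \<subseteq> ?I"
      unfolding *(3) using step[OF *(1,2), of "fst x" "snd x" for x]
      by (intro image_subsetI) (simp only: prod.collapse)
  qed
  moreover have "\<forall>\<Psi>\<in>?I. state_parts \<Psi> \<subseteq> insert (Top p0) (state_parts (PAnd \<Phi>1 \<Phi>2))"
    using I(4,8) by (auto; blast)
  moreover have "finite ?I" "PAnd \<Phi>1 \<Phi>2 \<in> ?I" using I(1,2,5,6) by auto
  ultimately show ?case by (intro exI[of _ ?I] conjI)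
qed

section \<open>Closed sets for strategic operators\<close>

lemma strat_op_comps:
  assumes "strat_op Q" "\<chi> \<in> comps p0 (Q \<Phi>)"
  shows "(\<exists>\<psi> \<Psi>. (\<psi>, \<Psi>) \<in> dec p0 \<Phi> \<and> (\<chi> = \<psi> \<or> \<chi> = And \<psi> (Q (PNext (Q \<Psi>))))) \<or>
    (\<exists>\<phi>. \<Phi> = PNext \<phi> \<and> (\<chi> = \<phi> \<or> \<chi> = Can {} (PNext \<phi>)))"
  using assms
  by (cases \<Phi>)
    (auto simp: strat_op_def comps_def dec_comps_def split: if_splits; blast)+

text \<open>Decomposition stays within a finite set of path formulae, and wrapping these in
  \<open>Q\<close> and a successor operator creates only finitely many further formulae over the
  closed sets of the state parts.\<close>

lemma closed_strat_op:
  assumes Q: "strat_op Q"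
    and IH: "\<And>\<phi>. \<phi> \<in> state_parts \<Phi> \<Longrightarrow> \<exists>S. finite S \<and> comp_closed p0 S \<and> \<phi> \<in> S"
  shows "\<exists>S. finite S \<and> comp_closed p0 S \<and> Q \<Phi> \<in> S"
proof -
  have fin: "finite (state_parts \<Phi>)" by (induction \<Phi> rule: pfm_induct) auto
  from IH obtain f where f: "\<And>\<phi>. \<phi> \<in> state_parts \<Phi> \<Longrightarrow> finite (f \<phi>) \<and> comp_closed p0 (f \<phi>) \<and> \<phi> \<in> f \<phi>"
    by metis
  define B where "B = {Top p0, Pos p0, Neg p0} \<union> (\<Union>\<phi>\<in>state_parts \<Phi>. f \<phi>)"
  have B: "finite B" "comp_closed p0 B" "insert (Top p0) (state_parts \<Phi>) \<subseteq> B"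
  proof -
    show "comp_closed p0 B"
      unfolding B_def using f by (intro comp_closed_Un comp_closed_Top comp_closed_UN) blast
  qed (use fin f in \<open>auto simp: B_def\<close>)
  obtain I where I': "finite I" "\<Phi> \<in> I" "\<forall>\<Psi>\<in>I. snd ` dec p0 \<Psi> \<subseteq> I"
    "\<forall>\<Psi>\<in>I. state_parts \<Psi> \<subseteq> insert (Top p0) (state_parts \<Phi>)"
    using dec_snd_closed[of \<Phi> p0] by (elim exE conjE) (rule that)
  note I = I'(1,2) bspec[OF I'(3)] bspec[OF I'(4)]
  have "\<exists>S'. finite S' \<and> comp_closed p0 S' \<and> B \<subseteq> S' \<and> fst ` dec p0 \<Psi> \<subseteq> S'" if "\<Psi> \<in> I" for \<Psi>
    using subset_trans[OF I(4)[OF that] B(3)] B(3) by (intro dec_fst_closed[OF B(1,2)]) simp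
  then obtain w where w: "\<And>\<Psi>. \<Psi> \<in> I \<Longrightarrow>
      finite (w \<Psi>) \<and> comp_closed p0 (w \<Psi>) \<and> B \<subseteq> w \<Psi> \<and> fst ` dec p0 \<Psi> \<subseteq> w \<Psi>"
    by metis
  define W where "W = (\<Union>\<Psi>\<in>I. w \<Psi>)"
  have W: "finite W" "comp_closed p0 W" "B \<subseteq> W" "\<And>\<psi> \<Psi> \<Phi>. \<Phi> \<in> I \<Longrightarrow> (\<psi>, \<Psi>) \<in> dec p0 \<Phi> \<Longrightarrow> \<psi> \<in> W"
  proof -
    show "finite W" "B \<subseteq> W" unfolding W_def using w I(1,2) by blast+
    show "comp_closed p0 W" unfolding W_def using w by (intro comp_closed_UN) blast
    show "\<psi> \<in> W" if "\<Phi> \<in> I" "(\<psi>, \<Psi>) \<in> dec p0 \<Phi>" for \<psi> \<Psi> \<Phi>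
      using w[OF that(1)] that imageI[OF that(2), of fst] unfolding W_def by auto
  qed
  \<comment> \<open>\<open>N\<close> and \<open>R\<close> hold the successor formulae and their
    bodies, \<open>K\<close> the conjunctive \<gamma>-components.\<close>
  define N where "N = (\<lambda>\<Psi>. Q (PNext (Q \<Psi>))) ` I"
  define R where "R = Q ` I"
  define K where "K = (\<lambda>(\<psi>, \<chi>). And \<psi> \<chi>) ` (W \<times> N)"
  \<comment> \<open>\<open>E\<close> receives the \<alpha>-components of
    \<open>Unav UNIV (PNext \<chi>)\<close>; the bodies of its members already lie in
    \<open>W\<close> or \<open>R\<close>.\<close>
  define E where "E = (\<lambda>\<chi>. Can {} (PNext \<chi>)) ` (W \<union> R)"
  define S where "S = W \<union> R \<union> N \<union> K \<union> E"
  have "comps p0 \<phi> \<subseteq> S" if "\<phi> \<in> S" for \<phi>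
  proof -
    have c1: "comps p0 (Q \<Psi>) \<subseteq> S" if "\<Psi> \<in> I" for \<Psi>
    proof
      fix \<chi> assume "\<chi> \<in> comps p0 (Q \<Psi>)"
      from strat_op_comps[OF Q this] show "\<chi> \<in> S"
      proof (elim disjE exE conjE)
        fix \<psi> \<Psi>' assume "(\<psi>, \<Psi>') \<in> dec p0 \<Psi>" "\<chi> = \<psi>"
        then show ?thesis using W(4)[OF that] by (auto simp: S_def)
      next
        fix \<psi> \<Psi>' assume d: "(\<psi>, \<Psi>') \<in> dec p0 \<Psi>" and c: "\<chi> = And \<psi> (Q (PNext (Q \<Psi>')))"
        have "\<Psi>' \<in> I" using I(3)[OF that] imageI[OF d, of snd] by auto
        then show ?thesis using c W(4)[OF that d] by (auto simp: S_def K_def N_def)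
      next
        fix \<phi> assume "\<Psi> = PNext \<phi>" "\<chi> = \<phi>"
        then show ?thesis using I(4)[OF that] B(3) W(3) by (auto simp: S_def)
      next
        fix \<phi> assume "\<Psi> = PNext \<phi>" "\<chi> = Can {} (PNext \<phi>)"
        then show ?thesis using I(4)[OF that] B(3) W(3) by (auto simp: S_def E_def)
      qed
    qed
    have c2: "comps p0 (Q (PNext (Q \<Psi>))) \<subseteq> S" if "\<Psi> \<in> I" for \<Psi>
    proof -
      have "comps p0 (Q (PNext (Q \<Psi>))) \<subseteq> {Q \<Psi>, Can {} (PNext (Q \<Psi>))}"
        using Q by (auto simp: strat_op_def comps_def split: if_splits)
      then show ?thesis using that by (auto simp: S_def R_def E_def)
    qed
    have c3: "comps p0 (And \<psi> \<chi>) \<subseteq> S" if "\<psi> \<in> W" "\<chi> \<in> N" for \<psi> \<chi>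
      using that by (auto simp: comps_def S_def)
    have c4: "comps p0 (Can {} (PNext \<chi>)) \<subseteq> S" if "\<chi> \<in> W \<union> R" for \<chi>
      using that by (auto simp: comps_def S_def)
    have c5: "comps p0 \<psi> \<subseteq> S" if "\<psi> \<in> W" for \<psi>
      using that W(2) by (auto simp: comp_closed_def S_def)
    consider "\<phi> \<in> W" | \<Psi> where "\<Psi> \<in> I" "\<phi> = Q \<Psi>" | \<Psi> where "\<Psi> \<in> I" "\<phi> = Q (PNext (Q \<Psi>))"
      | \<psi> \<chi> where "\<psi> \<in> W" "\<chi> \<in> N" "\<phi> = And \<psi> \<chi>" | \<chi> where "\<chi> \<in> W \<union> R" "\<phi> = Can {} (PNext \<chi>)"
      using \<open>\<phi> \<in> S\<close> unfolding S_def R_def K_def E_def by (auto simp: N_def; blast)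
    then show ?thesis by cases (simp_all only: c1 c2 c3 c4 c5)
  qed
  moreover have "finite S" "Q \<Phi> \<in> S"
    using W(1) I(1,2) by (auto simp: S_def R_def N_def K_def E_def)
  ultimately show ?thesis by (auto simp: comp_closed_def)
qed

text \<open>The second statement carries the induction hypothesis through path formulae to the state
  parts that \<open>closed_strat_op\<close> asks for.\<close>

lemma finite_comp_closed:
  fixes \<phi> :: "('ag, 'p) sfm" and \<Phi> :: "('ag, 'p) pfm"
  shows "\<exists>S. finite S \<and> comp_closed p0 S \<and> \<phi> \<in> S"
    and "\<forall>\<chi>\<in>state_parts \<Phi>. \<exists>S. finite S \<and> comp_closed p0 S \<and> \<chi> \<in> S"
proof (induction \<phi> and \<Phi> rule: sfm.induct pfm.induct)
  case (Pos p)
  then show ?case by (intro exI[of _ "{Pos p}"]) (auto simp: comp_closed_def comps_def)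
next
  case (Neg p)
  then show ?case by (intro exI[of _ "{Neg p}"]) (auto simp: comp_closed_def comps_def)
next
  case (Or \<phi> \<psi>)
  then obtain S S' where "finite S" "comp_closed p0 S" "\<phi> \<in> S" "finite S'" "comp_closed p0 S'" "\<psi> \<in> S'"
    by auto
  then show ?case
    by (intro exI[of _ "insert (Or \<phi> \<psi>) (S \<union> S')"]) (auto simp: comp_closed_def comps_def)
next
  case (And \<phi> \<psi>)
  then obtain S S' where "finite S" "comp_closed p0 S" "\<phi> \<in> S" "finite S'" "comp_closed p0 S'" "\<psi> \<in> S'"
    by auto
  then show ?case
    by (intro exI[of _ "insert (And \<phi> \<psi>) (S \<union> S')"]) (auto simp: comp_closed_def comps_def)
next
  case (Can A \<Phi>)
  show ?case
    by (rule closed_strat_op[of "Can A"]) (simp, rule bspec[OF Can])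
next
  case (Unav A \<Phi>)
  show ?case
    by (rule closed_strat_op[of "Unav A"]) (simp, rule bspec[OF Unav])
qed (simp_all add: ball_Un)

lemma finite_cl: "finite (cl p0 {\<eta>})"
proof -
  obtain S where S: "finite S" "comp_closed p0 S" "\<eta> \<in> S"
    using finite_comp_closed(1)[of p0 \<eta>] by (elim exE conjE) (rule that)
  let ?S = "S \<union> {Top p0, Pos p0, Neg p0} \<union> {Bot p0, Pos p0, Neg p0}"
  have c: "comp_closed p0 ?S"
    by (intro comp_closed_Un S comp_closed_Top comp_closed_Bot)
  have "\<phi> \<in> ?S" if "\<phi> \<in> cl p0 {\<eta>}" for \<phi>
    using that
  proof induction
    case (comp \<phi> \<psi>)
    then have "\<psi> \<in> comps p0 \<phi>" by (simp add: comps_def)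
    with c comp.IH show ?case unfolding comp_closed_def by blast
  qed (use S in auto)
  then have "cl p0 {\<eta>} \<subseteq> ?S" by blast
  then show ?thesis by (rule finite_subset) (use S(1) in auto)
qed

lemma cl_mono:
  assumes "G \<subseteq> cl p0 H" shows "cl p0 G \<subseteq> cl p0 H"
proof
  fix \<phi> assume "\<phi> \<in> cl p0 G"
  then show "\<phi> \<in> cl p0 H"
    by induction (use assms in \<open>auto intro: cl.intros\<close>)
qed


section \<open>Tableau states\<close>

definition tab_formulas :: "'p \<Rightarrow> ('ag, 'p) sfm \<Rightarrow> ('ag, 'p) sfm set" where
  "tab_formulas p0 \<eta> = insert (Can UNIV (PNext (Top p0))) (cl p0 {\<eta>})"

lemma finite_tab_formulas: "finite (tab_formulas p0 \<eta>)"
  by (simp add: tab_formulas_def finite_cl)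

lemma SR_subset: "D \<in> SR p0 G \<Longrightarrow> G \<subseteq> fst D"
  by (auto simp: SR_def full_expansion_def add_next_def)

lemma is_listingD:
  assumes "is_listing cs us" "finite (fst D)"
  shows "distinct (cs D)" "set (cs D) = {(A, \<phi>). Can A (PNext \<phi>) \<in> fst D}"
    "distinct (us D)" "set (us D) = {(A, \<psi>). Unav A (PNext \<psi>) \<in> fst D \<and> A \<noteq> UNIV}"
  using assms(1)[unfolded is_listing_def, rule_format, OF assms(2)] by simp_all

text \<open>Prestates remain inside the closure even after the default formula, because its body
  \<open>Top p0\<close> belongs to the closure.\<close>

lemma tab_state_subset:
  assumes "is_listing cs us"
  shows "prestate p0 cs us \<eta> G \<Longrightarrow> G \<subseteq> cl p0 {\<eta>}"
    and "tab_state p0 cs us \<eta> D \<Longrightarrow> fst D \<subseteq> tab_formulas p0 \<eta>"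
proof (induction rule: prestate_tab_state.inducts)
  case start
  then show ?case by (auto intro: cl.intros)
next
  case (SR G D)
  then obtain D1 where D1: "D = add_next p0 D1" "full_expansion p0 G D1" by (auto simp: SR_def)
  have "fst D1 \<subseteq> cl p0 G" using D1(2) unfolding full_expansion_def by (elim conjE)
  also have "\<dots> \<subseteq> cl p0 {\<eta>}" using SR(2) by (rule cl_mono)
  finally show ?case unfolding D1(1) add_next_def tab_formulas_def by auto
next
  case (Next D \<sigma>)
  \<comment> \<open>Listings are specified for finite labels only, so the inclusion for
    \<open>D\<close> is needed before its listing can be read.\<close>
  have fin: "finite (fst D)"
    by (rule finite_subset[OF Next(2) finite_tab_formulas])
  have 1: "\<phi> \<in> cl p0 {\<eta>}" if "Can A (PNext \<phi>) \<in> fst D" for A \<phi>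
  proof (cases "Can A (PNext \<phi>) \<in> cl p0 {\<eta>}")
    case True
    then show ?thesis by (rule cl.comp) simp
  next
    case False
    then have "\<phi> = Top p0" using subsetD[OF Next(2) that] by (simp add: tab_formulas_def)
    then show ?thesis by (simp add: cl.top)
  qed
  have 2: "\<phi> \<in> cl p0 {\<eta>}" if "Unav A (PNext \<phi>) \<in> fst D" "A \<noteq> UNIV" for A \<phi>
  proof (rule cl.comp)
    show "Unav A (PNext \<phi>) \<in> cl p0 {\<eta>}" using subsetD[OF Next(2) that(1)] by (simp add: tab_formulas_def)
  qed (use that in simp)
  have set: "set (cs D) = {(A, \<phi>). Can A (PNext \<phi>) \<in> fst D}"
    "set (us D) = {(A, \<psi>). Unav A (PNext \<psi>) \<in> fst D \<and> A \<noteq> UNIV}"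
    by (fact is_listingD[OF assms fin])+
  have "\<phi> \<in> cl p0 {\<eta>}" if "p < length (cs D)" "cs D ! p = (A, \<phi>)" for p A \<phi>
    using nth_mem[OF that(1)] that(2) 1 by (simp add: set)
  moreover have "\<phi> \<in> cl p0 {\<eta>}" if "q < length (us D)" "us D ! q = (A, \<phi>)" for q A \<phi>
    using nth_mem[OF that(1)] that(2) 2[of A \<phi>] by (simp add: set)
  ultimately show ?case
    unfolding next_prestate_def Let_def by (auto intro: cl.top)
qed

text \<open>What the model takes from a full expansion, freed from the prestate and in a form that
  survives \<open>add_next\<close>.\<close>

definition hintikka :: "'p \<Rightarrow> ('ag, 'p) tstate \<Rightarrow> bool" where
  "hintikka p0 D \<longleftrightarrow>
     (\<forall>p. \<not> (Pos p \<in> fst D \<and> Neg p \<in> fst D)) \<and>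
     (\<forall>\<phi>\<in>fst D. alpha_comps \<phi> \<subseteq> fst D) \<and>
     (\<forall>\<phi> \<psi>. Or \<phi> \<psi> \<in> fst D \<longrightarrow> \<phi> \<in> fst D \<or> \<psi> \<in> fst D) \<and>
     dom (snd D) = {\<xi> \<in> fst D. is_gamma \<xi>} \<and>
     (\<forall>\<xi> \<chi>. snd D \<xi> = Some \<chi> \<longrightarrow> \<chi> \<in> gamma_comps p0 \<xi> \<and> \<chi> \<in> fst D) \<and>
     has_next (fst D)"

lemma SR_hintikka: "D \<in> SR p0 G \<Longrightarrow> hintikka p0 D"
proof -
  assume "D \<in> SR p0 G"
  then obtain D1 where D1: "D = add_next p0 D1" "full_expansion p0 G D1" by (auto simp: SR_def)
  let ?N = "Can UNIV (PNext (Top p0))"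
  show ?thesis
  proof (cases "has_next (fst D1)")
    case True
    then have "D = D1" by (simp add: D1(1) add_next_def)
    then show ?thesis using D1(2) True unfolding full_expansion_def hintikka_def by blast
  next
    case False
    then have fst: "fst D = insert ?N (fst D1)" and snd: "snd D = snd D1"
      by (simp_all add: D1(1) add_next_def)
    have "has_next (fst D)" by (auto simp: fst has_next_def)
    \<comment> \<open>The added formula is not a \<gamma>-formula, so the links still cover exactly
      the \<gamma>-formulae of the label.\<close>
    moreover have "{\<xi> \<in> fst D. is_gamma \<xi>} = {\<xi> \<in> fst D1. is_gamma \<xi>}"
      by (auto simp: fst)
    ultimately show ?thesis using D1(2)
      unfolding full_expansion_def hintikka_def snd by (simp add: fst) blast
  qed
qed

lemma tab_state_hintikka: "tab_state p0 cs us \<eta> D \<Longrightarrow> hintikka p0 D"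
  by (auto elim: tab_state.cases dest: SR_hintikka)


section \<open>Decomposition and truth on plays\<close>

lemma sat_Top [simp]: "sat M (Top p0) s"
  by (simp add: Top_def)

text \<open>Hence every later member of a thread again gives a \<gamma>-formula, and its link
  exists.\<close>

lemma dec_not_PNext: "(\<psi>, \<Psi>) \<in> dec p0 \<Phi> \<Longrightarrow> \<Psi> \<noteq> PNext \<phi>"
  by (induction \<Phi> arbitrary: \<psi> \<Psi> rule: pfm_induct) auto

text \<open>The LTL expansion laws, read from the unfolding back to the formula; this is what pulls
  truth back along a thread.\<close>

lemma dec_sound:
  "(\<psi>, \<Psi>) \<in> dec p0 \<Phi> \<Longrightarrow> sat M \<psi> (l 0) \<Longrightarrow> psat M \<Psi> (\<lambda>i. l (Suc i)) \<Longrightarrow> psat M \<Phi> l"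
proof (induction \<Phi> arbitrary: \<psi> \<Psi> rule: pfm_induct)
  case (PBox \<phi>)
  then have "sat M \<phi> (l i)" for i by (cases i) auto
  then show ?case by simp
next
  case (PUntil \<phi> \<chi>)
  then consider "\<psi> = \<chi>" | "\<psi> = \<phi>" "\<Psi> = PUntil \<phi> \<chi>" by auto
  then show ?case
  proof cases
    case 1
    then show ?thesis using PUntil.prems(2) by auto
  next
    case 2
    then obtain i where i: "sat M \<chi> (l (Suc i))" "\<And>j. j < i \<Longrightarrow> sat M \<phi> (l (Suc j))"
      using PUntil.prems(3) by auto
    have "sat M \<phi> (l j)" if "j < Suc i" for j
      using that i(2) PUntil.prems(2) 2 by (cases j) auto
    then show ?thesis using i(1) by auto
  qed
qed (auto, blast)

text \<open>The weights make every proper continuation in \<open>dec\<close> smaller: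
  \<open>PUntil\<close> outweighs \<open>Top\<close>, \<open>PNext\<close> outweighs
  \<open>PState\<close>, and the extra unit for \<open>POr\<close> pays for dropping a disjunct of
  weight 0. A box merely repeats itself.\<close>

fun path_measure :: "'p \<Rightarrow> ('ag, 'p) pfm \<Rightarrow> nat" where
  "path_measure p0 (PState \<phi>) = (if \<phi> = Top p0 then 0 else 1)"
| "path_measure p0 (PNext \<phi>) = 2"
| "path_measure p0 (PBox \<phi>) = 0"
| "path_measure p0 (PUntil \<phi> \<psi>) = 1"
| "path_measure p0 (POr \<Phi> \<Psi>) = Suc (path_measure p0 \<Phi> + path_measure p0 \<Psi>)"
| "path_measure p0 (PAnd \<Phi> \<Psi>) = path_measure p0 \<Phi> + path_measure p0 \<Psi>"

lemma dec_measure: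
  "(\<psi>, \<Psi>) \<in> dec p0 \<Phi> \<Longrightarrow> \<Psi> = \<Phi> \<or> path_measure p0 \<Psi> < path_measure p0 \<Phi>"
proof (induction \<Phi> arbitrary: \<psi> \<Psi> rule: pfm_induct)
  case (POr \<Phi>1 \<Phi>2)
  from POr.prems consider "(\<psi>, \<Psi>) \<in> dec p0 \<Phi>1" | "(\<psi>, \<Psi>) \<in> dec p0 \<Phi>2"
    | \<psi>1 \<Psi>1 \<psi>2 \<Psi>2 where "(\<psi>1, \<Psi>1) \<in> dec p0 \<Phi>1" "(\<psi>2, \<Psi>2) \<in> dec p0 \<Phi>2" "\<Psi> = POr \<Psi>1 \<Psi>2"
    by auto
  then show ?case
  proof cases
    case 1
    from POr.IH(1)[OF this] show ?thesis by auto
  next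
    case 2
    from POr.IH(2)[OF this] show ?thesis by auto
  next
    case 3
    from POr.IH(1)[OF 3(1)] POr.IH(2)[OF 3(2)] 3(3) show ?thesis by auto
  qed
next
  case (PAnd \<Phi>1 \<Phi>2)
  from PAnd.prems obtain \<psi>1 \<Psi>1 \<psi>2 \<Psi>2 where
    3: "(\<psi>1, \<Psi>1) \<in> dec p0 \<Phi>1" "(\<psi>2, \<Psi>2) \<in> dec p0 \<Phi>2" "\<Psi> = PAnd \<Psi>1 \<Psi>2"
    by auto
  from PAnd.IH(1)[OF 3(1)] PAnd.IH(2)[OF 3(2)] 3(3) show ?case by auto
qed auto

text \<open>Constancy of a Boolean combination forces constancy of both arguments. So every
  \<open>PBox\<close> body and every left argument of \<open>PUntil\<close> is true at all times,
  and an until lacks only one moment for its right argument, which \<open>Real\<close>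
  supplies.\<close>

lemma stable_sound:
  assumes "\<And>i. \<exists>\<psi>. (\<psi>, \<Phi>) \<in> dec p0 \<Phi> \<and> sat M \<psi> (l i)" "Real \<Phi> {\<chi>. sat M \<chi> (l n)}"
  shows "psat M \<Phi> l"
  using assms
proof (induction \<Phi> rule: pfm_induct)
  case (PState \<phi>)
  then show ?case by simp
next
  case (PNext \<phi>)
  then show ?case by simp
next
  case (PBox \<phi>)
  then show ?case by simp
next
  case (PUntil \<phi> \<psi>)
  then show ?case by auto
next
  case (POr \<Phi>1 \<Phi>2)
  have split: "\<exists>\<psi>1 \<psi>2. ((\<psi>1, \<Phi>1) \<in> dec p0 \<Phi>1 \<and> sat M \<psi>1 (l i)) \<and> ((\<psi>2, \<Phi>2) \<in> dec p0 \<Phi>2 \<and> sat M \<psi>2 (l i))" for i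
  proof -
    obtain \<psi> where \<psi>: "(\<psi>, POr \<Phi>1 \<Phi>2) \<in> dec p0 (POr \<Phi>1 \<Phi>2)" "sat M \<psi> (l i)"
      using POr.prems(1) by blast
    \<comment> \<open>By \<open>dec_measure\<close> a disjunct cannot continue as the larger
      disjunction; so the pair comes from the third part of \<open>dec\<close>, where both disjuncts
      repeat.\<close>
    have "(\<psi>, POr \<Phi>1 \<Phi>2) \<notin> dec p0 \<Phi>1" "(\<psi>, POr \<Phi>1 \<Phi>2) \<notin> dec p0 \<Phi>2"
      using dec_measure[of \<psi> "POr \<Phi>1 \<Phi>2" p0] by fastforce+
    then show ?thesis using \<psi> by (auto; blast)
  qed
  from POr.prems(2) consider "Real \<Phi>1 {\<chi>. sat M \<chi> (l n)}" | "Real \<Phi>2 {\<chi>. sat M \<chi> (l n)}" by auto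
  then show ?case
  proof cases
    case 1
    have "psat M \<Phi>1 l" by (rule POr.IH(1)[OF _ 1]) (use split in blast)
    then show ?thesis by simp
  next
    case 2
    have "psat M \<Phi>2 l" by (rule POr.IH(2)[OF _ 2]) (use split in blast)
    then show ?thesis by simp
  qed
next
  case (PAnd \<Phi>1 \<Phi>2)
  have split: "\<exists>\<psi>1 \<psi>2. ((\<psi>1, \<Phi>1) \<in> dec p0 \<Phi>1 \<and> sat M \<psi>1 (l i)) \<and> ((\<psi>2, \<Phi>2) \<in> dec p0 \<Phi>2 \<and> sat M \<psi>2 (l i))" for i
    using PAnd.prems(1)[of i] by (auto; blast)
  have "psat M \<Phi>1 l" by (rule PAnd.IH(1)) (use split PAnd.prems(2) in auto)
  moreover have "psat M \<Phi>2 l" by (rule PAnd.IH(2)) (use split PAnd.prems(2) in auto)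
  ultimately show ?case by simp
qed

text \<open>Used to pass from membership in a label to truth: \<open>Real\<close> inspects state
  parts only, and for these the truth lemma is available by induction.\<close>

lemma Real_mono:
  "Real \<Phi> X \<Longrightarrow> (\<And>\<chi>. \<chi> \<in> state_parts \<Phi> \<Longrightarrow> \<chi> \<in> X \<Longrightarrow> \<chi> \<in> Y) \<Longrightarrow> Real \<Phi> Y"
  by (induction \<Phi> rule: pfm_induct) auto


section \<open>Ranked realization\<close>

text \<open>A formula for \<open>Unav UNIV\<close> is never listed; its \<alpha>-component belongs
  to the empty coalition, which every move satisfies.\<close>

fun triggers ::
    "('ag, 'p) listing \<Rightarrow> ('ag, 'p) listing \<Rightarrow> ('ag, 'p) tstate \<Rightarrow> ('ag, 'p) sfm \<Rightarrow> ('ag \<Rightarrow> nat) set" where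
  "triggers cs us D (Can A (PNext \<chi>)) =
     {\<sigma>. \<exists>p<length (cs D). cs D ! p = (A, \<chi>) \<and> \<sigma> \<in> can_moves cs us D p A}"
| "triggers cs us D (Unav A (PNext \<chi>)) =
     (if A = UNIV then moves cs us D
      else {\<sigma>. \<exists>q<length (us D). us D ! q = (A, \<chi>) \<and> \<sigma> \<in> unav_moves cs us D q A})"
| "triggers cs us D _ = {}"

lemma triggers_subset_moves: "triggers cs us D \<phi> \<subseteq> moves cs us D"
  by (cases "(cs, us, D, \<phi>)" rule: triggers.cases)
    (auto simp: can_moves_def unav_moves_def split: if_splits)

lemma finite_moves: "finite (moves cs us (D :: ('ag::finite, 'p) tstate))"
proof -
  have "moves cs us D = (UNIV :: 'ag set) \<rightarrow>\<^sub>E {..<length (cs D) + length (us D)}"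
    by (auto simp: moves_def PiE_def)
  then show ?thesis by (simp add: finite_PiE)
qed

fun real_now :: "('ag, 'p) sfm \<Rightarrow> ('ag, 'p) tstate \<Rightarrow> bool" where
  "real_now (Can A \<Phi>) D \<longleftrightarrow> Real \<Phi> (fst D)"
| "real_now (Unav A \<Phi>) D \<longleftrightarrow> Real \<Phi> (fst D)"
| "real_now _ D \<longleftrightarrow> False"

lemma real_now_strat_op: "strat_op Q \<Longrightarrow> real_now (Q \<Phi>) D \<longleftrightarrow> Real \<Phi> (fst D)"
  by (auto elim: strat_op_cases)

text \<open>Isolates the facts about a final tableau: failure of the two elimination rules becomes
  \<open>edge_ex\<close> and \<open>gamma_realized\<close>. \<open>focus\<close> is a fair schedule
  that names each formula at arbitrarily late times.\<close>

locale pruned_tableau =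
  fixes p0 :: 'p and cs us :: "('ag::finite, 'p) listing"
    and T :: "('ag, 'p) tstate set" and D0 :: "('ag, 'p) tstate"
    and focus :: "nat \<Rightarrow> ('ag, 'p) sfm"
  assumes listing: "is_listing cs us"
    and fin: "D \<in> T \<Longrightarrow> finite (fst D)"
    and hint: "D \<in> T \<Longrightarrow> hintikka p0 D"
    and edge_ex: "D \<in> T \<Longrightarrow> \<sigma> \<in> moves cs us D \<Longrightarrow> \<exists>D'. edge p0 cs us T D \<sigma> D'"
    and gamma_realized: "D \<in> T \<Longrightarrow> \<xi> \<in> fst D \<Longrightarrow> is_gamma \<xi> \<Longrightarrow> realized p0 cs us T \<xi> D"
    and D0: "D0 \<in> T"
    and focus: "D \<in> T \<Longrightarrow> \<xi> \<in> fst D \<Longrightarrow> \<exists>n\<ge>m. focus n = \<xi>"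
begin

text \<open>Realization with a bound on its depth, so that progress is measured by a number. The
  variable \<open>Q\<close> merges the three step rules of \<open>realized\<close>.\<close>

primrec realized_within :: "nat \<Rightarrow> ('ag, 'p) sfm \<Rightarrow> ('ag, 'p) tstate \<Rightarrow> bool" where
  "realized_within 0 \<xi> D \<longleftrightarrow> real_now \<xi> D"
| "realized_within (Suc n) \<xi> D \<longleftrightarrow> real_now \<xi> D \<or>
     (\<exists>Q \<Phi> \<psi> \<xi>'. strat_op Q \<and> \<xi> = Q \<Phi> \<and> snd D \<xi> = Some (And \<psi> (Q (PNext \<xi>'))) \<and>
        (\<forall>\<sigma>\<in>triggers cs us D (Q (PNext \<xi>')). \<exists>D'. edge p0 cs us T D \<sigma> D' \<and> realized_within n \<xi>' D'))"

lemma realized_within_mono: "realized_within n \<xi> D \<Longrightarrow> n \<le> m \<Longrightarrow> realized_within m \<xi> D"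
proof (induction n arbitrary: m \<xi> D)
  case 0
  then show ?case by (cases m) auto
next
  case (Suc n)
  obtain m' where m: "m = Suc m'" "n \<le> m'" using Suc.prems(2) by (cases m) auto
  show ?case
  proof (cases "real_now \<xi> D")
    case True
    then show ?thesis by (simp add: m)
  next
    case False
    then obtain Q \<Phi> \<psi> \<xi>' where *: "strat_op Q" "\<xi> = Q \<Phi>" "snd D \<xi> = Some (And \<psi> (Q (PNext \<xi>')))"
      "\<forall>\<sigma>\<in>triggers cs us D (Q (PNext \<xi>')). \<exists>D'. edge p0 cs us T D \<sigma> D' \<and> realized_within n \<xi>' D'"
      using Suc.prems(1) unfolding realized_within.simps by (elim disjE exE conjE) (simp, rule that)
    have "\<forall>\<sigma>\<in>triggers cs us D (Q (PNext \<xi>')). \<exists>D'. edge p0 cs us T D \<sigma> D' \<and> realized_within m' \<xi>' D'"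
      using *(4) Suc.IH[OF _ m(2)] by meson
    then show ?thesis unfolding m(1) realized_within.simps
      by (intro disjI2 exI conjI) (rule *)+
  qed
qed

text \<open>There are finitely many moves, so the depths required for the single moves have a
  maximum.\<close>

lemma realized_within_step:
  assumes "strat_op Q" "snd D (Q \<Phi>) = Some (And \<psi> (Q (PNext \<xi>')))"
    and "\<forall>\<sigma>\<in>triggers cs us D (Q (PNext \<xi>')). \<exists>D'. edge p0 cs us T D \<sigma> D' \<and> (\<exists>n. realized_within n \<xi>' D')"
  shows "\<exists>n. realized_within n (Q \<Phi>) D"
proof -
  let ?X = "triggers cs us D (Q (PNext \<xi>'))"
  obtain f where f: "\<And>\<sigma>. \<sigma> \<in> ?X \<Longrightarrow> \<exists>D'. edge p0 cs us T D \<sigma> D' \<and> realized_within (f \<sigma>) \<xi>' D'"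
    using assms(3) by metis
  have fX: "finite ?X" by (rule finite_subset[OF triggers_subset_moves finite_moves])
  have "\<forall>\<sigma>\<in>?X. \<exists>D'. edge p0 cs us T D \<sigma> D' \<and> realized_within (Max (f ` ?X)) \<xi>' D'"
  proof
    fix \<sigma> assume "\<sigma> \<in> ?X"
    then have "f \<sigma> \<le> Max (f ` ?X)" using fX by simp
    then show "\<exists>D'. edge p0 cs us T D \<sigma> D' \<and> realized_within (Max (f ` ?X)) \<xi>' D'"
      using f[OF \<open>\<sigma> \<in> ?X\<close>] realized_within_mono by meson
  qed
  then have "realized_within (Suc (Max (f ` ?X))) (Q \<Phi>) D"
    unfolding realized_within.simps by (intro disjI2 exI conjI) (rule assms refl)+
  then show ?thesis ..
qed

lemma realized_imp_within: "realized p0 cs us T \<xi> D \<Longrightarrow> \<exists>n. realized_within n \<xi> D"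
proof (induction rule: realized.induct)
  case (can_now D A \<Phi>)
  then show ?case by (intro exI[of _ 0]) simp
next
  case (unav_now D A \<Phi>)
  then show ?case by (intro exI[of _ 0]) simp
next
  case (can_step D A \<Phi> \<psi> \<xi>' p)
  \<comment> \<open>The entries of a listing are distinct, so the position found in
    \<open>triggers\<close> is \<open>p\<close> itself.\<close>
  have "triggers cs us D (Can A (PNext \<xi>')) \<subseteq> can_moves cs us D p A"
    using is_listingD(1)[OF listing fin[OF can_step(1)]] can_step(4,5)
    by (auto simp: distinct_conv_nth) metis
  then show ?case using can_step(6)
    by (intro realized_within_step[OF strat_op_simps(1) can_step(3)] ballI) (meson subsetD)
next
  case (unav_step D A \<Phi> \<psi> \<xi>' q)
  have "(A, \<xi>') \<in> set (us D)" using unav_step(4,5) nth_mem by metis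
  then have "A \<noteq> UNIV" using is_listingD(4)[OF listing fin[OF unav_step(1)]] by simp
  then have "triggers cs us D (Unav A (PNext \<xi>')) \<subseteq> unav_moves cs us D q A"
    using is_listingD(3)[OF listing fin[OF unav_step(1)]] unav_step(4,5)
    by (auto simp: distinct_conv_nth) metis
  then show ?case using unav_step(6)
    by (intro realized_within_step[OF strat_op_simps(2) unav_step(3)] ballI) (meson subsetD)
next
  case (unav_all_step D \<Phi> \<psi> \<xi>' p)
  have "triggers cs us D (Unav UNIV (PNext \<xi>')) \<subseteq> can_moves cs us D p {}"
    by (simp add: can_moves_def)
  then show ?case using unav_all_step(6)
    by (intro realized_within_step[OF strat_op_simps(2) unav_all_step(3)] ballI) (meson subsetD)
qed

definition rank :: "('ag, 'p) sfm \<Rightarrow> ('ag, 'p) tstate \<Rightarrow> nat" where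
  "rank \<xi> D = (LEAST n. realized_within n \<xi> D)"

text \<open>Without \<open>Real\<close> the least depth is positive and unfolds to successors of
  smaller depth; the link is a function of the formula and so fixes which successor formula this
  unfolding speaks about.\<close>

lemma rank_less:
  assumes Q: "strat_op Q" and D: "D \<in> T" "Q \<Phi> \<in> fst D" "is_gamma (Q \<Phi>)"
    and now: "\<not> Real \<Phi> (fst D)"
    and link: "snd D (Q \<Phi>) = Some (And \<psi> (Q (PNext \<xi>')))"
    and \<sigma>: "\<sigma> \<in> triggers cs us D (Q (PNext \<xi>'))"
  shows "\<exists>D'. edge p0 cs us T D \<sigma> D' \<and> rank \<xi>' D' < rank (Q \<Phi>) D"
proof -
  have "realized_within (rank (Q \<Phi>) D) (Q \<Phi>) D"
    unfolding rank_def using realized_imp_within[OF gamma_realized[OF D]] by (rule LeastI_ex)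
  moreover have "\<not> real_now (Q \<Phi>) D" using now by (simp add: real_now_strat_op[OF Q])
  ultimately obtain n Q' \<Phi>' \<psi>' \<xi>'' where n: "rank (Q \<Phi>) D = Suc n" and
    r: "strat_op Q'" "Q \<Phi> = Q' \<Phi>'" "snd D (Q \<Phi>) = Some (And \<psi>' (Q' (PNext \<xi>'')))"
      "\<forall>\<sigma>\<in>triggers cs us D (Q' (PNext \<xi>'')). \<exists>D'. edge p0 cs us T D \<sigma> D' \<and> realized_within n \<xi>'' D'"
    by (cases "rank (Q \<Phi>) D") auto
  have "Q' (PNext \<xi>'') = Q (PNext \<xi>')" using link r(3) by simp
  moreover from this have "\<xi>'' = \<xi>'" using Q r(1) by (auto elim!: strat_op_cases)
  ultimately obtain D' where "edge p0 cs us T D \<sigma> D'" "realized_within n \<xi>' D'"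
    using r(4) \<sigma> by auto
  moreover from this(2) have "rank \<xi>' D' \<le> n" unfolding rank_def by (rule Least_le)
  ultimately show ?thesis using n by (intro exI[of _ D']) simp
qed


section \<open>The model\<close>

text \<open>Both ranks belong to the same formula, which fits an eventuality linked to itself, as in
  a stabilized thread.\<close>

definition lowers ::
    "('ag, 'p) sfm \<Rightarrow> ('ag, 'p) tstate \<Rightarrow> ('ag \<Rightarrow> nat) \<Rightarrow> ('ag, 'p) tstate \<Rightarrow> bool" where
  "lowers \<xi> D \<sigma> D' \<longleftrightarrow> edge p0 cs us T D \<sigma> D' \<and> rank \<xi> D' < rank \<xi> D"

text \<open>
  In the pair \<open>(D, n)\<close> the formula \<open>focus n\<close> is the eventuality being served at \<open>D\<close>. It is kept as
  long as a successor lowers its rank, hence only for finitely many steps in a row.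
\<close>

definition step ::
    "('ag, 'p) tstate \<times> nat \<Rightarrow> ('ag \<Rightarrow> nat) \<Rightarrow> ('ag, 'p) tstate \<times> nat" where
  "step x \<sigma> =
     (if \<sigma> \<notin> moves cs us (fst x) then (fst x, Suc (snd x))
      else if \<exists>D'. lowers (focus (snd x)) (fst x) \<sigma> D'
      then (SOME D'. lowers (focus (snd x)) (fst x) \<sigma> D', snd x)
      else (SOME D'. edge p0 cs us T (fst x) \<sigma> D', Suc (snd x)))"

text \<open>The model is a tree: a state encodes the finite sequence of moves that leads to it.\<close>

definition node :: "nat \<Rightarrow> ('ag, 'p) tstate \<times> nat" where
  "node s = foldl step (D0, 0) (from_nat s)"

text \<open>There are finitely many agents, so lists of moves are countable and \<open>nat\<close>
  can serve as the type of states. A number that encodes no list is read as some list by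
  \<open>from_nat\<close>.\<close>

definition tree_succ :: "nat \<Rightarrow> ('ag \<Rightarrow> nat) \<Rightarrow> nat" where
  "tree_succ s \<sigma> = to_nat (from_nat s @ [\<sigma>])"

definition tst :: "nat \<Rightarrow> ('ag, 'p) tstate" where
  "tst s = fst (node s)"

definition cnt :: "nat \<Rightarrow> nat" where
  "cnt s = snd (node s)"

lemma node_tree_succ: "node (tree_succ s \<sigma>) = step (node s) \<sigma>"
  by (simp add: node_def tree_succ_def)

lemma edge_in: "edge p0 cs us T D \<sigma> D' \<Longrightarrow> D' \<in> T"
  by (simp add: edge_def)

lemma step_edge:
  assumes "fst x \<in> T" "\<sigma> \<in> moves cs us (fst x)"
  shows "edge p0 cs us T (fst x) \<sigma> (fst (step x \<sigma>))"
proof (cases "\<exists>D'. lowers (focus (snd x)) (fst x) \<sigma> D'")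
  case True
  then have "lowers (focus (snd x)) (fst x) \<sigma> (fst (step x \<sigma>))"
    using assms(2) by (simp only: step_def if_True if_False fst_conv not_not simp_thms) (rule someI_ex)
  then show ?thesis by (simp add: lowers_def)
next
  case False
  then have "fst (step x \<sigma>) = (SOME D'. edge p0 cs us T (fst x) \<sigma> D')"
    using assms(2) by (simp only: step_def if_True if_False fst_conv not_not simp_thms)
  then show ?thesis using someI_ex[OF edge_ex[OF assms]] by (simp only:)
qed

lemma step_in: "fst x \<in> T \<Longrightarrow> fst (step x \<sigma>) \<in> T"
proof (cases "\<sigma> \<in> moves cs us (fst x)")
  case True
  then show "fst x \<in> T \<Longrightarrow> ?thesis" using step_edge edge_in by meson
qed (simp add: step_def)

lemma tst_in: "tst s \<in> T"
proof -
  have "fst (foldl step x ws) \<in> T" if "fst x \<in> T" for x ws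
    using that by (induction ws arbitrary: x) (simp_all add: step_in)
  then show ?thesis using D0 by (simp add: tst_def node_def)
qed

lemma tst_edge: "\<sigma> \<in> moves cs us (tst s) \<Longrightarrow> edge p0 cs us T (tst s) \<sigma> (tst (tree_succ s \<sigma>))"
  using step_edge[of "node s" \<sigma>] tst_in[of s] by (simp add: tst_def node_tree_succ)

lemma cnt_stays:
  assumes "\<sigma> \<in> moves cs us (tst s)" "lowers (focus (cnt s)) (tst s) \<sigma> D'"
  shows "cnt (tree_succ s \<sigma>) = cnt s"
proof -
  have "\<exists>D'. lowers (focus (cnt s)) (tst s) \<sigma> D'" using assms(2) by (rule exI)
  then show ?thesis
    using assms(1) unfolding cnt_def tst_def node_tree_succ
    by (simp only: step_def if_True if_False snd_conv not_not simp_thms)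
qed

text \<open>Either the counter advances or a natural number drops, so the counter cannot stand still
  forever.\<close>

lemma cnt_cases:
  assumes "\<sigma> \<in> moves cs us (tst s)"
  shows "cnt (tree_succ s \<sigma>) = Suc (cnt s) \<or> cnt (tree_succ s \<sigma>) = cnt s \<and>
    rank (focus (cnt s)) (tst (tree_succ s \<sigma>)) < rank (focus (cnt s)) (tst s)"
proof (cases "\<exists>D'. lowers (focus (cnt s)) (tst s) \<sigma> D'")
  case True
  then have "tst (tree_succ s \<sigma>) = (SOME D'. lowers (focus (cnt s)) (tst s) \<sigma> D')"
    using assms unfolding cnt_def tst_def node_tree_succ
    by (simp only: step_def if_True if_False fst_conv not_not simp_thms)
  then have "lowers (focus (cnt s)) (tst s) \<sigma> (tst (tree_succ s \<sigma>))"
    using someI_ex[OF True] by (simp only:)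
  then show ?thesis using cnt_stays[OF assms] by (simp add: lowers_def)
next
  case False
  then show ?thesis
    using assms unfolding cnt_def tst_def node_tree_succ
    by (simp only: step_def if_True if_False snd_conv not_not simp_thms)
qed

definition tab_model :: "('ag, nat, nat, 'p) cgm" where
  "tab_model = \<lparr>St = UNIV, Act = (\<lambda>_. UNIV),
     act = (\<lambda>_ s. {..<length (cs (tst s)) + length (us (tst s))}),
     out = tree_succ, lab = (\<lambda>s. {p. Pos p \<in> fst (tst s)})\<rparr>"

lemma tab_model_simps [simp]:
  "St tab_model = UNIV" "Act tab_model a = UNIV"
  "act tab_model a s = {..<length (cs (tst s)) + length (us (tst s))}"
  "out tab_model = tree_succ" "lab tab_model s = {p. Pos p \<in> fst (tst s)}"
  by (simp_all add: tab_model_def)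

lemma tst_listing:
  "distinct (cs (tst s))" "set (cs (tst s)) = {(A, \<phi>). Can A (PNext \<phi>) \<in> fst (tst s)}"
  "distinct (us (tst s))" "set (us (tst s)) = {(A, \<psi>). Unav A (PNext \<psi>) \<in> fst (tst s) \<and> A \<noteq> UNIV}"
  by (fact is_listingD[OF listing fin[OF tst_in]])+

lemma tst_hintikka:
  "\<not> (Pos p \<in> fst (tst s) \<and> Neg p \<in> fst (tst s))"
  "\<phi> \<in> fst (tst s) \<Longrightarrow> \<psi> \<in> alpha_comps \<phi> \<Longrightarrow> \<psi> \<in> fst (tst s)"
  "Or \<phi> \<psi> \<in> fst (tst s) \<Longrightarrow> \<phi> \<in> fst (tst s) \<or> \<psi> \<in> fst (tst s)"
  "\<xi> \<in> fst (tst s) \<Longrightarrow> is_gamma \<xi> \<Longrightarrow>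
    \<exists>\<chi>. snd (tst s) \<xi> = Some \<chi> \<and> \<chi> \<in> gamma_comps p0 \<xi> \<and> \<chi> \<in> fst (tst s)"
  "has_next (fst (tst s))"
proof -
  note h = hint[OF tst_in[of s], unfolded hintikka_def]
  show "\<not> (Pos p \<in> fst (tst s) \<and> Neg p \<in> fst (tst s))" using h by (elim conjE) (rule spec)
  show "\<phi> \<in> fst (tst s) \<Longrightarrow> \<psi> \<in> alpha_comps \<phi> \<Longrightarrow> \<psi> \<in> fst (tst s)"
    using h by (elim conjE) (drule bspec, assumption, erule subsetD)
  show "Or \<phi> \<psi> \<in> fst (tst s) \<Longrightarrow> \<phi> \<in> fst (tst s) \<or> \<psi> \<in> fst (tst s)" using h by meson
  show "has_next (fst (tst s))" using h by (elim conjE)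
  show "\<exists>\<chi>. snd (tst s) \<xi> = Some \<chi> \<and> \<chi> \<in> gamma_comps p0 \<xi> \<and> \<chi> \<in> fst (tst s)"
    if "\<xi> \<in> fst (tst s)" "is_gamma \<xi>"
  proof -
    have "dom (snd (tst s)) = {\<xi> \<in> fst (tst s). is_gamma \<xi>}" using h by (elim conjE)
    then have "\<xi> \<in> dom (snd (tst s))" using that by simp
    then obtain \<chi> where "snd (tst s) \<xi> = Some \<chi>" by (auto simp: dom_def)
    then show ?thesis using h by (elim conjE) (intro exI[of _ \<chi>], simp)
  qed
qed

lemma cs_index:
  assumes "Can A (PNext \<phi>) \<in> fst (tst s)"
  obtains p where "p < length (cs (tst s))" "cs (tst s) ! p = (A, \<phi>)"
proof -
  have "(A, \<phi>) \<in> set (cs (tst s))" using assms by (simp add: tst_listing)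
  then show ?thesis using that by (auto simp: in_set_conv_nth)
qed

lemma us_index:
  assumes "Unav A (PNext \<phi>) \<in> fst (tst s)" "A \<noteq> UNIV"
  obtains q where "q < length (us (tst s))" "us (tst s) ! q = (A, \<phi>)"
proof -
  have "(A, \<phi>) \<in> set (us (tst s))" using assms by (simp add: tst_listing)
  then show ?thesis using that by (auto simp: in_set_conv_nth)
qed

text \<open>Every label has a successor formula, if necessary the default of
  \<open>add_next\<close>; the unlisted kind, \<open>Unav UNIV\<close>, has a listed
  \<alpha>-component. Action sets are therefore nonempty.\<close>

lemma some_move: "0 < length (cs (tst s)) + length (us (tst s))"
proof -
  from tst_hintikka(5)[of s] obtain A \<phi> where "Can A (PNext \<phi>) \<in> fst (tst s) \<or> Unav A (PNext \<phi>) \<in> fst (tst s)"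
    by (auto simp: has_next_def)
  moreover have "Can {} (PNext \<phi>) \<in> fst (tst s)" if "Unav UNIV (PNext \<phi>) \<in> fst (tst s)" for \<phi>
    by (rule tst_hintikka(2)[OF that]) simp
  ultimately consider B where "Can B (PNext \<phi>) \<in> fst (tst s)" | "Unav A (PNext \<phi>) \<in> fst (tst s)" "A \<noteq> UNIV"
    by (cases "A = UNIV") auto
  then show ?thesis
    by cases (auto elim: cs_index us_index)
qed

lemma profiles_tab_model: "profiles tab_model s = moves cs us (tst s)"
  by (auto simp: actions_def moves_def PiE_def)

lemma is_cgm_tab_model: "is_cgm tab_model"
  using some_move by (simp add: is_cgm_def lessThan_empty_iff)

lemma plays_tab_model:
  "l \<in> plays tab_model \<longleftrightarrow> (\<forall>i. \<exists>\<sigma>\<in>moves cs us (tst (l i)). l (Suc i) = tree_succ (l i) \<sigma>)"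
  by (simp add: plays_def profiles_tab_model)

text \<open>The prestate reached by a triggering move contains \<chi>, and a state extends the
  prestate that it expands.\<close>

lemma triggers_succ:
  assumes Q: "strat_op Q" and mem: "Q (PNext \<chi>) \<in> fst (tst s)"
    and \<sigma>: "\<sigma> \<in> triggers cs us (tst s) (Q (PNext \<chi>))"
  shows "\<chi> \<in> fst (tst (tree_succ s \<sigma>))"
proof -
  have m: "\<sigma> \<in> moves cs us (tst s)" using \<sigma> triggers_subset_moves by (rule rev_subsetD)
  have "\<chi> \<in> next_prestate p0 cs us (tst s) \<sigma>"
    using Q
  proof (cases rule: strat_op_cases)
    case (1 A)
    then show ?thesis using \<sigma> by (auto simp: next_prestate_def Let_def)
  next
    case (2 A)
    show ?thesis
    proof (cases "A = UNIV")
      case True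
      \<comment> \<open>Here \<chi> enters the prestate through the listed
        \<alpha>-component.\<close>
      have "Can {} (PNext \<chi>) \<in> fst (tst s)" by (rule tst_hintikka(2)[OF mem]) (simp add: 2 True)
      then obtain p where "p < length (cs (tst s))" "cs (tst s) ! p = ({}, \<chi>)" by (rule cs_index)
      then show ?thesis using m by (auto simp: next_prestate_def Let_def can_moves_def)
    next
      case False
      then show ?thesis using \<sigma> 2 by (auto simp: next_prestate_def Let_def)
    qed
  qed
  moreover have "tst (tree_succ s \<sigma>) \<in> SR p0 (next_prestate p0 cs us (tst s) \<sigma>)"
    using tst_edge[OF m] by (simp add: edge_def)
  ultimately show ?thesis using SR_subset by (meson subsetD)
qed


section \<open>Enforcing successor formulas\<close>

text \<open>Common abstraction of consistency with a strategy and with a co-strategy;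
  \<open>g\<close> names the goal after each history. The demand is conditional because strategies
  must act also where the goal formula is absent.\<close>

definition follows ::
    "(('ag, 'p) pfm \<Rightarrow> ('ag, 'p) sfm) \<Rightarrow> (nat list \<Rightarrow> ('ag, 'p) sfm) \<Rightarrow> (nat \<Rightarrow> nat) \<Rightarrow> bool" where
  "follows Q g l \<longleftrightarrow> (\<forall>i. \<exists>\<sigma>\<in>moves cs us (tst (l i)). l (Suc i) = tree_succ (l i) \<sigma> \<and>
     (Q (PNext (g (prefix_upto l i))) \<in> fst (tst (l i)) \<longrightarrow>
      \<sigma> \<in> triggers cs us (tst (l i)) (Q (PNext (g (prefix_upto l i))))))"

lemma last_prefix_upto [simp]: "last (prefix_upto l i) = l i"
  by (simp add: prefix_upto_def)

text \<open>All members of \<open>A\<close> vote for the position of the formula in the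
  listing.\<close>

lemma can_action:
  "\<exists>\<tau>\<in>actions tab_model A s. Can A (PNext \<chi>) \<in> fst (tst s) \<longrightarrow>
     (\<forall>\<sigma>\<in>moves cs us (tst s). (\<forall>a\<in>A. \<sigma> a = \<tau> a) \<longrightarrow> \<sigma> \<in> triggers cs us (tst s) (Can A (PNext \<chi>)))"
proof (cases "Can A (PNext \<chi>) \<in> fst (tst s)")
  case True
  then obtain p where "p < length (cs (tst s))" "cs (tst s) ! p = (A, \<chi>)" by (rule cs_index)
  then show ?thesis
    by (intro bexI[of _ "\<lambda>a\<in>A. p"]) (auto simp: actions_def can_moves_def)
next
  case False
  then show ?thesis using some_move[of s]
    by (intro bexI[of _ "\<lambda>a\<in>A. 0"]) (auto simp: actions_def)
qed

text \<open>The reply may depend on \<open>f\<close>: the agents outside \<open>A\<close> all vote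
  for unavoidable formulae, and one of them steers the sum to the wanted residue.\<close>

lemma unav_action:
  assumes f: "f \<in> actions tab_model A s"
  shows "\<exists>\<tau>\<in>actions tab_model (- A) s. Unav A (PNext \<chi>) \<in> fst (tst s) \<longrightarrow>
     (\<lambda>a. if a \<in> A then f a else \<tau> a) \<in> triggers cs us (tst s) (Unav A (PNext \<chi>))"
proof (cases "Unav A (PNext \<chi>) \<in> fst (tst s) \<and> A \<noteq> UNIV")
  case True
  then obtain q where q: "q < length (us (tst s))" "us (tst s) ! q = (A, \<chi>)" by (auto elim: us_index)
  define m where "m = length (cs (tst s))"
  define k where "k = length (us (tst s))"
  define S where "S = (\<Sum>a\<in>{a \<in> A. m \<le> f a}. f a - m)"
  obtain b where b: "b \<notin> A" using True by auto
  \<comment> \<open>The offset of agent \<open>b\<close> corrects the sum \<open>S\<close> of the others to \<open>q\<close> modulo \<open>k\<close>.\<close>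
  define t where "t = (q + (k - 1) * S) mod k"
  have k: "0 < k" using q by (auto simp: k_def)
  have "(S + t) mod k = (S + (q + (k - 1) * S)) mod k" by (simp add: t_def mod_add_right_eq)
  \<comment> \<open>\<open>(k - 1) * S\<close> acts as -S modulo \<open>k\<close> while avoiding
    subtraction of sums on naturals.\<close>
  also have "S + (q + (k - 1) * S) = q + k * S" using k by (cases k) auto
  also have "\<dots> mod k = q" using q by (simp add: k_def)
  finally have St: "(S + t) mod k = q" .
  have t: "t < k" using k by (simp add: t_def)
  define \<tau> where "\<tau> = (\<lambda>a\<in>- A. if a = b then m + t else m)"
  define \<sigma> where "\<sigma> = (\<lambda>a. if a \<in> A then f a else \<tau> a)"
  have \<tau>: "\<tau> \<in> actions tab_model (- A) s"
    using t k by (auto simp: actions_def \<tau>_def m_def[symmetric] k_def[symmetric])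
  have fA: "f a < m + k" if "a \<in> A" for a
    using f that by (auto simp: actions_def m_def k_def)
  have moves: "\<sigma> \<in> moves cs us (tst s)"
    unfolding moves_def m_def[symmetric] k_def[symmetric] using fA t k by (simp add: \<sigma>_def \<tau>_def)
  have N: "Nset cs (tst s) \<sigma> = {a \<in> A. m \<le> f a} \<union> - A"
    by (auto simp: Nset_def m_def[symmetric] \<sigma>_def \<tau>_def)
  have "(\<Sum>a\<in>- A. \<sigma> a - m) = (\<Sum>a\<in>- A. if a = b then t else 0)"
    by (rule sum.cong) (auto simp: \<sigma>_def \<tau>_def)
  also have "\<dots> = t" using b by simp
  finally have sum2: "(\<Sum>a\<in>- A. \<sigma> a - m) = t" .
  have sum1: "(\<Sum>a\<in>{a \<in> A. m \<le> f a}. \<sigma> a - m) = S"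
    unfolding S_def by (rule sum.cong) (auto simp: \<sigma>_def)
  have "(\<Sum>a\<in>Nset cs (tst s) \<sigma>. \<sigma> a - m) = S + t"
    unfolding N sum1[symmetric] sum2[symmetric] by (rule sum.union_disjoint) auto
  then have "co cs us (tst s) \<sigma> = q"
    using St by (simp add: co_def m_def k_def)
  then have "\<sigma> \<in> triggers cs us (tst s) (Unav A (PNext \<chi>))"
    using True q moves N by (auto simp: unav_moves_def)
  then show ?thesis using \<tau> unfolding \<sigma>_def by (intro bexI[of _ \<tau>]) simp
next
  case False
  \<comment> \<open>If \<open>A\<close> is \<open>UNIV\<close>, every available move triggers the
    formula; otherwise the premise fails and action 0 is a mere default.\<close>
  have "(\<lambda>a. if a \<in> A then f a else 0) \<in> moves cs us (tst s)"
    using f some_move[of s] by (auto simp: actions_def moves_def)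
  then show ?thesis using False some_move[of s]
    by (intro bexI[of _ "\<lambda>a\<in>- A. 0"]) (auto simp: actions_def)
qed

text \<open>The strategy picks an action from \<open>can_action\<close> at each history, so every
  consistent play follows the goal \<open>g\<close>.\<close>

lemma sat_CanI:
  assumes "\<And>l. l 0 = s \<Longrightarrow> follows (Can A) g l \<Longrightarrow> psat tab_model \<Phi> l"
  shows "sat tab_model (Can A \<Phi>) s"
proof -
  define P where "P h \<tau> \<longleftrightarrow> \<tau> \<in> actions tab_model A (last h) \<and> (Can A (PNext (g h)) \<in> fst (tst (last h)) \<longrightarrow>
     (\<forall>\<sigma>\<in>moves cs us (tst (last h)). (\<forall>a\<in>A. \<sigma> a = \<tau> a) \<longrightarrow>
        \<sigma> \<in> triggers cs us (tst (last h)) (Can A (PNext (g h)))))" for h \<tau>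
  have P: "P h (SOME \<tau>. P h \<tau>)" for h
    using can_action[of A "last h" "g h"] unfolding P_def Bex_def by (rule someI_ex)
  define F where "F = (\<lambda>h\<in>histories tab_model. SOME \<tau>. P h \<tau>)"
  have "F \<in> strategies tab_model A"
    using P by (auto simp: F_def strategies_def P_def)
  moreover have "follows (Can A) g l" if l: "consistent tab_model A F l" for l
    unfolding follows_def
  proof
    fix i
    let ?h = "prefix_upto l i"
    have "?h \<in> histories tab_model" using l by (auto simp: histories_def consistent_def)
    then have P': "P ?h (F ?h)" using P by (simp add: F_def)
    obtain \<sigma> where \<sigma>: "\<sigma> \<in> moves cs us (tst (l i))" "\<forall>a\<in>A. \<sigma> a = F ?h a" "l (Suc i) = tree_succ (l i) \<sigma>"
      using l unfolding consistent_def profiles_tab_model tab_model_simps by blast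
    show "\<exists>\<sigma>\<in>moves cs us (tst (l i)). l (Suc i) = tree_succ (l i) \<sigma> \<and>
       (Can A (PNext (g ?h)) \<in> fst (tst (l i)) \<longrightarrow> \<sigma> \<in> triggers cs us (tst (l i)) (Can A (PNext (g ?h))))"
      by (rule bexI[OF _ \<sigma>(1)]) (use \<sigma> P' in \<open>simp add: P_def del: triggers.simps\<close>)
  qed
  ultimately show ?thesis using assms by auto
qed

text \<open>A co-strategy chooses after both the history and the strategy \<open>F\<close> are
  known, which is the order of quantifiers in \<open>unav_action\<close>.\<close>

lemma sat_UnavI:
  assumes "\<And>l. l 0 = s \<Longrightarrow> follows (Unav A) g l \<Longrightarrow> psat tab_model \<Phi> l"
  shows "sat tab_model (Unav A \<Phi>) s"
proof -
  define P where "P h F \<tau> \<longleftrightarrow> \<tau> \<in> actions tab_model (- A) (last h) \<and>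
     (Unav A (PNext (g h)) \<in> fst (tst (last h)) \<longrightarrow>
      (\<lambda>a. if a \<in> A then F h a else \<tau> a) \<in> triggers cs us (tst (last h)) (Unav A (PNext (g h))))" for h F \<tau>
  have P: "P h F (SOME \<tau>. P h F \<tau>)" if "F \<in> strategies tab_model A" "h \<in> histories tab_model" for h F
  proof -
    have "F h \<in> actions tab_model A (last h)" using that by (auto simp: strategies_def)
    from unav_action[OF this, of "g h"] show ?thesis unfolding P_def Bex_def by (rule someI_ex)
  qed
  define Fc where "Fc = (\<lambda>h\<in>histories tab_model. \<lambda>F\<in>strategies tab_model A. SOME \<tau>. P h F \<tau>)"
  have "(SOME \<tau>. P h F \<tau>) \<in> actions tab_model (- A) (last h)"
    if "F \<in> strategies tab_model A" "h \<in> histories tab_model" for h F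
    using P[OF that] unfolding P_def by (rule conjunct1)
  then have "Fc \<in> co_strategies tab_model A"
    unfolding Fc_def co_strategies_def by (intro restrict_PiE_iff[THEN iffD2] ballI)
  moreover have "follows (Unav A) g l" if l: "co_consistent tab_model A Fc l" for l
    unfolding follows_def
  proof
    fix i
    let ?h = "prefix_upto l i"
    obtain F where F: "F \<in> strategies tab_model A"
      "l (Suc i) = tree_succ (l i) (\<lambda>a. if a \<in> A then F ?h a else Fc ?h F a)"
      using l by (auto simp: co_consistent_def)
    have h: "?h \<in> histories tab_model" using l by (auto simp: histories_def co_consistent_def)
    have P': "P ?h F (Fc ?h F)" using P[OF F(1) h] F(1) h by (simp add: Fc_def)
    let ?\<sigma> = "\<lambda>a. if a \<in> A then F ?h a else Fc ?h F a"
    have "F ?h \<in> actions tab_model A (l i)"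
      using PiE_mem[OF F(1)[unfolded strategies_def] h] by simp
    moreover have "Fc ?h F \<in> actions tab_model (- A) (l i)"
      using conjunct1[OF P'[unfolded P_def]] by simp
    ultimately have \<sigma>: "?\<sigma> \<in> moves cs us (tst (l i))"
      by (auto simp: actions_def moves_def PiE_iff)
    show "\<exists>\<sigma>\<in>moves cs us (tst (l i)). l (Suc i) = tree_succ (l i) \<sigma> \<and>
       (Unav A (PNext (g ?h)) \<in> fst (tst (l i)) \<longrightarrow> \<sigma> \<in> triggers cs us (tst (l i)) (Unav A (PNext (g ?h))))"
      by (rule bexI[OF _ \<sigma>]) (use F(2) P' in \<open>simp add: P_def del: triggers.simps\<close>)
  qed
  ultimately show ?thesis using assms by auto
qed

lemma sat_strat_opI:
  assumes "strat_op Q" "\<And>l. l 0 = s \<Longrightarrow> follows Q g l \<Longrightarrow> psat tab_model \<Phi> l"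
  shows "sat tab_model (Q \<Phi>) s"
  using assms(1)
proof (cases rule: strat_op_cases)
  case (1 A)
  show ?thesis unfolding 1 by (rule sat_CanI) (rule assms(2)[unfolded 1])
next
  case (2 A)
  show ?thesis unfolding 2 by (rule sat_UnavI) (rule assms(2)[unfolded 2])
qed


section \<open>Truth lemma\<close>

lemma cnt_increments:
  assumes "l \<in> plays tab_model"
  shows "\<exists>j>i. cnt (l j) = Suc (cnt (l i))"
proof (induction "rank (focus (cnt (l i))) (tst (l i))" arbitrary: i rule: less_induct)
  case less
  obtain \<sigma> where "\<sigma> \<in> moves cs us (tst (l i))" "l (Suc i) = tree_succ (l i) \<sigma>"
    using assms by (auto simp: plays_tab_model)
  then have "cnt (l (Suc i)) = Suc (cnt (l i)) \<or> cnt (l (Suc i)) = cnt (l i) \<and>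
      rank (focus (cnt (l i))) (tst (l (Suc i))) < rank (focus (cnt (l i))) (tst (l i))"
    using cnt_cases by simp
  then show ?case
  proof
    assume "cnt (l (Suc i)) = Suc (cnt (l i))"
    then show ?thesis by (intro exI[of _ "Suc i"]) simp
  next
    assume c: "cnt (l (Suc i)) = cnt (l i) \<and>
      rank (focus (cnt (l i))) (tst (l (Suc i))) < rank (focus (cnt (l i))) (tst (l i))"
    then obtain j where "j > Suc i" "cnt (l j) = Suc (cnt (l (Suc i)))" using less[of "Suc i"] by auto
    then show ?thesis using c by (intro exI[of _ j]) simp
  qed
qed

lemma cnt_reaches:
  assumes "l \<in> plays tab_model" "cnt (l N) \<le> v"
  shows "\<exists>i\<ge>N. cnt (l i) = v"
  using assms(2)
proof (induction v rule: dec_induct)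
  case base
  then show ?case by auto
next
  case (step v)
  then obtain i where "i \<ge> N" "cnt (l i) = v" by auto
  moreover obtain j where "j > i" "cnt (l j) = Suc (cnt (l i))" using cnt_increments[OF assms(1)] by blast
  ultimately show ?case by (intro exI[of _ j]) simp
qed

text \<open>If \<open>Real\<close> failed forever, then once \<open>Q \<Phi>\<close> comes into
  focus every further step could lower its rank; the counter would stop, against
  \<open>cnt_increments\<close>.\<close>

lemma eventually_real:
  assumes Q: "strat_op Q" and gamma: "is_gamma (Q \<Phi>)" and l: "l \<in> plays tab_model"
    and thread: "\<And>i. i \<ge> N \<Longrightarrow> Q \<Phi> \<in> fst (tst (l i)) \<and>
      (\<exists>\<psi>. snd (tst (l i)) (Q \<Phi>) = Some (And \<psi> (Q (PNext (Q \<Phi>))))) \<and>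
      (\<exists>\<sigma>\<in>triggers cs us (tst (l i)) (Q (PNext (Q \<Phi>))). l (Suc i) = tree_succ (l i) \<sigma>)"
  shows "\<exists>n\<ge>N. Real \<Phi> (fst (tst (l n)))"
proof (rule ccontr)
  assume no: "\<not> ?thesis"
  \<comment> \<open>The schedule returns to \<open>Q \<Phi>\<close> at a value that the counter has
    not yet passed.\<close>
  obtain v where v: "v \<ge> cnt (l N)" "focus v = Q \<Phi>"
    using focus[OF tst_in] thread[of N] by blast
  obtain i where i: "i \<ge> N" "cnt (l i) = v" using cnt_reaches[OF l v(1)] by auto
  have "cnt (l j) = v" if "j \<ge> i" for j
    using that
  proof (induction j rule: dec_induct)
    case base
    show ?case by (rule i(2))
  next
    case (step j)
    have jN: "j \<ge> N" using step.hyps i(1) by simp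
    from thread[OF jN] obtain \<psi> \<sigma> where
      \<sigma>: "snd (tst (l j)) (Q \<Phi>) = Some (And \<psi> (Q (PNext (Q \<Phi>))))"
        "\<sigma> \<in> triggers cs us (tst (l j)) (Q (PNext (Q \<Phi>)))" "l (Suc j) = tree_succ (l j) \<sigma>"
      by blast
    have "\<not> Real \<Phi> (fst (tst (l j)))" using no jN by blast
    then obtain D' where "edge p0 cs us T (tst (l j)) \<sigma> D'" "rank (Q \<Phi>) D' < rank (Q \<Phi>) (tst (l j))"
      using rank_less[OF Q tst_in conjunct1[OF thread[OF jN]] gamma _ \<sigma>(1,2)] by blast
    then have "lowers (focus (cnt (l j))) (tst (l j)) \<sigma> D'"
      by (simp add: lowers_def step.IH v(2))
    then have "cnt (tree_succ (l j) \<sigma>) = cnt (l j)"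
      by (rule cnt_stays[OF subsetD[OF triggers_subset_moves \<sigma>(2)]])
    then show ?case using \<sigma>(3) step.IH by simp
  qed
  moreover obtain j where "j > i" "cnt (l j) = Suc (cnt (l i))" using cnt_increments[OF l] by blast
  ultimately show False using i(2) by (metis less_imp_le n_not_Suc_n)
qed

section \<open>Threads of path formulae and truth of labels\<close>

definition next_path ::
    "(('ag, 'p) pfm \<Rightarrow> ('ag, 'p) sfm) \<Rightarrow> ('ag, 'p) pfm \<Rightarrow> nat \<Rightarrow> ('ag, 'p) pfm" where
  "next_path Q \<Phi> s = (SOME \<Psi>. \<exists>\<psi>. (\<psi>, \<Psi>) \<in> dec p0 \<Phi> \<and>
     snd (tst s) (Q \<Phi>) = Some (if \<Psi> = PState (Top p0) then \<psi> else And \<psi> (Q (PNext (Q \<Psi>)))))"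

text \<open>The shape of a linked component need not reveal the pair of \<open>dec\<close> behind
  it; any pair that explains the link will do. A successor is demanded only while the path part
  differs from \<open>Top\<close>.\<close>

lemma next_path:
  assumes Q: "strat_op Q" and mem: "Q \<Phi> \<in> fst (tst s)" and gamma: "is_gamma (Q \<Phi>)"
  obtains \<psi> where "(\<psi>, next_path Q \<Phi> s) \<in> dec p0 \<Phi>" "\<psi> \<in> fst (tst s)"
    "next_path Q \<Phi> s \<noteq> PState (Top p0) \<Longrightarrow>
       snd (tst s) (Q \<Phi>) = Some (And \<psi> (Q (PNext (Q (next_path Q \<Phi> s)))))"
    "next_path Q \<Phi> s \<noteq> PState (Top p0) \<Longrightarrow> Q (PNext (Q (next_path Q \<Phi> s))) \<in> fst (tst s)"
proof -
  obtain \<chi> where \<chi>: "snd (tst s) (Q \<Phi>) = Some \<chi>" "\<chi> \<in> gamma_comps p0 (Q \<Phi>)" "\<chi> \<in> fst (tst s)"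
    using tst_hintikka(4)[OF mem gamma] by (elim exE conjE)
  have "\<exists>\<Psi> \<psi>. (\<psi>, \<Psi>) \<in> dec p0 \<Phi> \<and>
      snd (tst s) (Q \<Phi>) = Some (if \<Psi> = PState (Top p0) then \<psi> else And \<psi> (Q (PNext (Q \<Psi>))))"
    using \<chi>(1,2) unfolding gamma_comps_strat_op[OF Q gamma] dec_comps_def
    by (elim CollectE exE conjE) (intro exI conjI, assumption, simp only:)
  from someI_ex[OF this] obtain \<psi> where
    \<psi>: "(\<psi>, next_path Q \<Phi> s) \<in> dec p0 \<Phi>" "snd (tst s) (Q \<Phi>) = Some (if next_path Q \<Phi> s = PState (Top p0)
        then \<psi> else And \<psi> (Q (PNext (Q (next_path Q \<Phi> s)))))"
    unfolding next_path_def[symmetric] by (elim exE conjE)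
  show ?thesis
  proof (cases "next_path Q \<Phi> s = PState (Top p0)")
    case True
    then show ?thesis using \<psi> \<chi> by (intro that[of \<psi>]) simp_all
  next
    case False
    then have \<chi>': "\<chi> = And \<psi> (Q (PNext (Q (next_path Q \<Phi> s))))" using \<psi>(2) \<chi>(1) by simp
    have "\<psi> \<in> fst (tst s)" "Q (PNext (Q (next_path Q \<Phi> s))) \<in> fst (tst s)"
      by (rule tst_hintikka(2)[OF \<chi>(3)], simp add: \<chi>')+
    then show ?thesis using \<psi>(1) \<chi>(1) \<chi>' by (intro that[of \<psi>]) simp_all
  qed
qed

text \<open>The state formula of a pair is \<open>Top\<close> or a conjunction of state parts, and
  labels are closed under conjuncts.\<close>

lemma dec_fst_sat:
  assumes "(\<psi>, \<Psi>) \<in> dec p0 \<Phi>" "\<psi> \<in> fst (tst s)"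
    and "\<And>\<chi>. \<chi> \<in> state_parts \<Phi> \<Longrightarrow> \<chi> \<in> fst (tst s) \<Longrightarrow> sat tab_model \<chi> s"
  shows "sat tab_model \<psi> s"
proof -
  have And: "\<phi> \<in> fst (tst s) \<and> \<chi> \<in> fst (tst s)" if "And \<phi> \<chi> \<in> fst (tst s)" for \<phi> \<chi>
    by (intro conjI; rule tst_hintikka(2)[OF that]; simp)
  show ?thesis
    using assms
  proof (induction \<Phi> arbitrary: \<psi> \<Psi> rule: pfm_induct)
    case (POr \<Phi>1 \<Phi>2)
    from POr.prems(1) consider "(\<psi>, \<Psi>) \<in> dec p0 \<Phi>1" | "(\<psi>, \<Psi>) \<in> dec p0 \<Phi>2"
      | \<psi>1 \<Psi>1 \<psi>2 \<Psi>2 where "(\<psi>1, \<Psi>1) \<in> dec p0 \<Phi>1" "(\<psi>2, \<Psi>2) \<in> dec p0 \<Phi>2" "\<psi> = And \<psi>1 \<psi>2"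
      by auto
    then show ?case
    proof cases
      case 1
      show ?thesis by (rule POr.IH(1)[OF 1 POr.prems(2)]) (rule POr.prems(3), simp_all)
    next
      case 2
      show ?thesis by (rule POr.IH(2)[OF 2 POr.prems(2)]) (rule POr.prems(3), simp_all)
    next
      case 3
      then have m: "\<psi>1 \<in> fst (tst s)" "\<psi>2 \<in> fst (tst s)" using And[of \<psi>1 \<psi>2] POr.prems(2) by simp_all
      have "sat tab_model \<psi>1 s"
        by (rule POr.IH(1)[OF 3(1) m(1)]) (rule POr.prems(3), simp_all)
      moreover have "sat tab_model \<psi>2 s"
        by (rule POr.IH(2)[OF 3(2) m(2)]) (rule POr.prems(3), simp_all)
      ultimately show ?thesis by (simp add: 3(3))
    qed
  next
    case (PAnd \<Phi>1 \<Phi>2)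
    from PAnd.prems(1) obtain \<psi>1 \<Psi>1 \<psi>2 \<Psi>2 where
      3: "(\<psi>1, \<Psi>1) \<in> dec p0 \<Phi>1" "(\<psi>2, \<Psi>2) \<in> dec p0 \<Phi>2" "\<psi> = And \<psi>1 \<psi>2"
      by auto
    then have m: "\<psi>1 \<in> fst (tst s)" "\<psi>2 \<in> fst (tst s)" using And[of \<psi>1 \<psi>2] PAnd.prems(2) by simp_all
    have "sat tab_model \<psi>1 s"
      by (rule PAnd.IH(1)[OF 3(1) m(1)]) (rule PAnd.prems(3), simp_all)
    moreover have "sat tab_model \<psi>2 s"
      by (rule PAnd.IH(2)[OF 3(2) m(2)]) (rule PAnd.prems(3), simp_all)
    ultimately show ?case by (simp add: 3(3))
  qed auto
qed

text \<open>Folding \<open>next_path\<close> over the history gives a goal that depends on the past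
  alone, as a strategy requires. Truth is pulled back from the point where the thread ends or
  stabilizes.\<close>

lemma gamma_psat:
  assumes Q: "strat_op Q" and mem: "Q \<Phi> \<in> fst (tst (l 0))" and gamma: "is_gamma (Q \<Phi>)"
    and follows: "follows Q (\<lambda>h. Q (foldl (next_path Q) \<Phi> h)) l"
    and parts: "\<And>\<chi> s. \<chi> \<in> state_parts \<Phi> \<Longrightarrow> \<chi> \<in> fst (tst s) \<Longrightarrow> sat tab_model \<chi> s"
  shows "psat tab_model \<Phi> l"
proof -
  \<comment> \<open>\<open>F i\<close> is the obligation before \<open>l i\<close> is read, whereas
    the goal at the history ending in \<open>l i\<close> is already
    \<open>F (Suc i)\<close>.\<close>
  define F where "F i = foldl (next_path Q) \<Phi> (map l [0..<i])" for i
  define holds where "holds \<chi> \<longleftrightarrow> (\<forall>s. \<chi> \<in> fst (tst s) \<longrightarrow> sat tab_model \<chi> s)" for \<chi>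
  let ?top = "PState (Top p0)"
  have F0: "F 0 = \<Phi>" by (simp add: F_def)
  have FS: "F (Suc i) = next_path Q (F i) (l i)" for i by (simp add: F_def)
  have g: "foldl (next_path Q) \<Phi> (prefix_upto l i) = F (Suc i)" for i
    unfolding F_def prefix_upto_def ..
  have l: "l \<in> plays tab_model"
    using follows by (auto simp: plays_tab_model follows_def)
  have step: "\<exists>\<sigma>. l (Suc i) = tree_succ (l i) \<sigma> \<and> (Q (PNext (Q (F (Suc i)))) \<in> fst (tst (l i)) \<longrightarrow>
      \<sigma> \<in> triggers cs us (tst (l i)) (Q (PNext (Q (F (Suc i))))))" for i
    using follows unfolding follows_def g by blast
  \<comment> \<open>Only positive indices are restricted: \<open>Q \<Phi>\<close> is in the first
    label by assumption even if \<Phi> is \<open>Top\<close>, whereas a later \<open>Top\<close>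
    ends the thread and need not show up in a label.\<close>
  have inv: "Q (F i) \<in> fst (tst (l i)) \<and> is_gamma (Q (F i)) \<and> (\<forall>\<chi>\<in>state_parts (F i). holds \<chi>)"
    if "\<And>j. 0 < j \<Longrightarrow> j \<le> i \<Longrightarrow> F j \<noteq> ?top" for i
    using that
  proof (induction i)
    case 0
    then show ?case using mem gamma parts by (simp add: F0 holds_def)
  next
    case (Suc i)
    then have IH: "Q (F i) \<in> fst (tst (l i))" "is_gamma (Q (F i))" "\<forall>\<chi>\<in>state_parts (F i). holds \<chi>" by auto
    have nt: "F (Suc i) \<noteq> ?top" using Suc.prems by simp
    obtain \<psi> where \<psi>: "(\<psi>, F (Suc i)) \<in> dec p0 (F i)" "Q (PNext (Q (F (Suc i)))) \<in> fst (tst (l i))"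
      using next_path[OF Q IH(1,2)] nt unfolding FS by metis
    have "Q (F (Suc i)) \<in> fst (tst (l (Suc i)))"
      using step[of i] \<psi>(2) triggers_succ[OF Q \<psi>(2)] by auto
    moreover have "is_gamma (Q (F (Suc i)))"
      unfolding is_gamma_strat_op[OF Q] using dec_not_PNext[OF \<psi>(1)] by simp
    moreover have "holds (Top p0)" by (simp add: holds_def)
    then have "\<forall>\<chi>\<in>state_parts (F (Suc i)). holds \<chi>"
      using dec_state_parts[OF \<psi>(1)] IH(3) by auto
    ultimately show ?case by simp
  qed
  have dec_sat: "\<exists>\<psi>. (\<psi>, F (Suc i)) \<in> dec p0 (F i) \<and> sat tab_model \<psi> (l i)"
    if "\<And>j. 0 < j \<Longrightarrow> j \<le> i \<Longrightarrow> F j \<noteq> ?top" for i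
  proof -
    note I = inv[OF that]
    obtain \<psi> where \<psi>: "(\<psi>, F (Suc i)) \<in> dec p0 (F i)" "\<psi> \<in> fst (tst (l i))"
      using next_path[OF Q conjunct1[OF I]] I unfolding FS by metis
    have "sat tab_model \<psi> (l i)"
      by (rule dec_fst_sat[OF \<psi>]) (use I in \<open>simp add: holds_def\<close>)
    with \<psi>(1) show ?thesis by blast
  qed
  \<comment> \<open>The bound on \<open>j\<close> is strict because \<open>F i\<close> itself may be
    the terminal \<open>Top\<close>.\<close>
  have backward: "psat tab_model \<Phi> l"
    if "psat tab_model (F i) (\<lambda>k. l (i + k))" "\<And>j. 0 < j \<Longrightarrow> j < i \<Longrightarrow> F j \<noteq> ?top" for i
    using that
  proof (induction i)
    case 0
    then show ?case by (simp add: F0)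
  next
    case (Suc i)
    obtain \<psi> where \<psi>: "(\<psi>, F (Suc i)) \<in> dec p0 (F i)" "sat tab_model \<psi> (l i)"
      using dec_sat[of i] Suc.prems(2) by auto
    have "psat tab_model (F i) (\<lambda>k. l (i + k))"
      by (rule dec_sound[OF \<psi>(1)]) (use \<psi>(2) Suc.prems(1) in simp_all)
    then show ?case using Suc by simp
  qed
  show ?thesis
  proof (cases "\<exists>i>0. F i = ?top")
    case True
    define i where "i = (LEAST i. 0 < i \<and> F i = ?top)"
    have "0 < i \<and> F i = ?top" unfolding i_def using True by (rule LeastI_ex)
    moreover have "F j \<noteq> ?top" if "0 < j" "j < i" for j
      using not_less_Least[OF that(2)[unfolded i_def]] that(1) by simp
    ultimately show ?thesis by (intro backward[of i]) simp_all
  next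
    case False
    then have nt: "F j \<noteq> ?top" if "0 < j" for j using that by blast
    note inv' = inv[OF nt] and dec_sat' = dec_sat[OF nt]
    \<comment> \<open>From an index of minimal measure on, \<open>dec_measure\<close> leaves
      equality as the only possibility.\<close>
    obtain N where N: "\<And>i. path_measure p0 (F N) \<le> path_measure p0 (F i)"
      using ex_has_least_nat[of "\<lambda>_. True" undefined "\<lambda>i. path_measure p0 (F i)"] by auto
    have stable: "F i = F N" if "i \<ge> N" for i
      using that
    proof (induction i rule: dec_induct)
      case (step i)
      obtain \<psi> where "(\<psi>, F (Suc i)) \<in> dec p0 (F i)" using dec_sat' by blast
      from dec_measure[OF this] N[of "Suc i"] step.IH show ?case by auto
    qed simp
    have stable': "F (Suc i) = F N" if "i \<ge> N" for i using stable[of "Suc i"] that by simp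
    have thread: "Q (F N) \<in> fst (tst (l i)) \<and>
      (\<exists>\<psi>. snd (tst (l i)) (Q (F N)) = Some (And \<psi> (Q (PNext (Q (F N)))))) \<and>
      (\<exists>\<sigma>\<in>triggers cs us (tst (l i)) (Q (PNext (Q (F N)))). l (Suc i) = tree_succ (l i) \<sigma>)"
      if "i \<ge> N" for i
    proof -
      have I: "Q (F N) \<in> fst (tst (l i))" "is_gamma (Q (F N))"
        using inv'[of i] stable[OF that] by simp_all
      have nx: "next_path Q (F N) (l i) = F N" using FS[of i] stable[OF that] stable'[OF that] by simp
      have "F N \<noteq> ?top" using nt[of "Suc i"] stable'[OF that] by simp
      then obtain \<psi> where "snd (tst (l i)) (Q (F N)) = Some (And \<psi> (Q (PNext (Q (F N)))))"
        "Q (PNext (Q (F N))) \<in> fst (tst (l i))"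
        using next_path[OF Q I] unfolding nx by metis
      then show ?thesis using I(1) step[of i] unfolding stable'[OF that] by blast
    qed
    obtain n where n: "n \<ge> N" "Real (F N) (fst (tst (l n)))"
      using eventually_real[OF Q _ l thread] inv'[of N] by blast
    have "psat tab_model (F N) (\<lambda>k. l (N + k))"
    proof (rule stable_sound)
      show "\<exists>\<psi>. (\<psi>, F N) \<in> dec p0 (F N) \<and> sat tab_model \<psi> (l (N + k))" for k
        using dec_sat'[of "N + k"] stable[of "N + k"] stable'[of "N + k"] by simp
      show "Real (F N) {\<chi>. sat tab_model \<chi> (l (N + (n - N)))}"
        by (rule Real_mono[OF n(2)]) (use inv'[of N] n(1) in \<open>simp add: holds_def\<close>)
    qed
    then show ?thesis by (rule backward) (rule nt)
  qed
qed

lemma strat_op_truth: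
  assumes Q: "strat_op Q" and mem: "Q \<Phi> \<in> fst (tst s)"
    and parts: "\<And>\<chi> s. \<chi> \<in> state_parts \<Phi> \<Longrightarrow> \<chi> \<in> fst (tst s) \<Longrightarrow> sat tab_model \<chi> s"
  shows "sat tab_model (Q \<Phi>) s"
proof (cases "is_gamma (Q \<Phi>)")
  case True
  show ?thesis
    by (rule sat_strat_opI[OF Q]) (rule gamma_psat[OF Q _ True _ parts], use mem in simp_all)
next
  case False
  then obtain \<chi> where \<chi>: "\<Phi> = PNext \<chi>" using is_gamma_strat_op[OF Q] by blast
  show ?thesis
  proof (rule sat_strat_opI[OF Q])
    \<comment> \<open>A constant goal suffices, since \<open>PNext\<close> concerns the first step
      alone.\<close>
    fix l assume l: "l 0 = s" "follows Q (\<lambda>_. \<chi>) l"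
    have "Q (PNext \<chi>) \<in> fst (tst (l 0))" using mem \<chi> l(1) by simp
    then obtain \<sigma> where "l (Suc 0) = tree_succ (l 0) \<sigma>" "\<sigma> \<in> triggers cs us (tst (l 0)) (Q (PNext \<chi>))"
      using l(2) unfolding follows_def by blast
    then have "\<chi> \<in> fst (tst (l (Suc 0)))" using triggers_succ[OF Q] mem \<chi> l(1) by simp
    then show "psat tab_model \<Phi> l" using parts[of \<chi>] by (simp add: \<chi>)
  qed
qed

text \<open>The statement on path formulae provides the hypothesis on state parts at all states, as
  a strategic operator needs it along whole plays.\<close>

lemma truth:
  fixes \<phi> :: "('ag, 'p) sfm" and \<Phi> :: "('ag, 'p) pfm"
  shows "\<forall>s. \<phi> \<in> fst (tst s) \<longrightarrow> sat tab_model \<phi> s"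
    and "\<forall>\<chi>\<in>state_parts \<Phi>. \<forall>s. \<chi> \<in> fst (tst s) \<longrightarrow> sat tab_model \<chi> s"
proof (induction \<phi> and \<Phi> rule: sfm.induct pfm.induct)
  case (Neg p)
  then show ?case using tst_hintikka(1) by auto
next
  case (Or \<phi> \<psi>)
  then show ?case using tst_hintikka(3) by fastforce
next
  case (And \<phi> \<psi>)
  then show ?case using tst_hintikka(2)[of "And \<phi> \<psi>"] by simp
next
  case (Can A \<Phi>)
  then show ?case using strat_op_truth[OF strat_op_simps(1)] by blast
next
  case (Unav A \<Phi>)
  then show ?case using strat_op_truth[OF strat_op_simps(2)] by blast
qed (simp_all add: ball_Un)

lemma root: "tst (to_nat ([] :: ('ag \<Rightarrow> nat) list)) = D0"
  by (simp add: tst_def node_def)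

end

section \<open>From the final tableau to a model of \<eta>\<close>

lemma fair_enumeration:
  assumes "finite X"
  obtains f :: "nat \<Rightarrow> 'a" where "\<And>x m. x \<in> X \<Longrightarrow> \<exists>n\<ge>m. f n = x"
proof -
  obtain xs where xs: "set xs = X" using finite_list[OF assms] by auto
  have "\<exists>n\<ge>m. xs ! (n mod length xs) = x" if x: "x \<in> X" for x m
  proof -
    obtain i where i: "i < length xs" "xs ! i = x" using x xs by (auto simp: in_set_conv_nth)
    have "m * 1 \<le> m * length xs" using i(1) by (intro mult_le_mono2) simp
    then have "m \<le> i + m * length xs" by linarith
    then show ?thesis using i by (intro exI[of _ "i + m * length xs"]) simp
  qed
  then show ?thesis by (rule that[of "\<lambda>n. xs ! (n mod length xs)"])
qed

theorem theorem5:
  fixes \<eta> :: "('ag::finite, 'p) sfm"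
    and p0 :: 'p
    and cs us :: "('ag, 'p) listing"
    and T :: "('ag, 'p) tstate set"
  assumes "is_listing cs us"
    and "final_tableau p0 cs us \<eta> T"
    and "open_tableau \<eta> T"
  shows "\<exists>(M :: ('ag, nat, nat, 'p) cgm) s. is_cgm M \<and> s \<in> St M \<and> sat M \<eta> s"
proof -
  obtain D0 where root_state: "D0 \<in> T" "\<eta> \<in> fst D0" using assms(3) by (auto simp: open_tableau_def)
  have "(eliminate p0 cs us)\<^sup>*\<^sup>* (initial_tableau p0 cs us \<eta>) T"
    using assms(2) by (simp add: final_tableau_def)
  \<comment> \<open>Elimination only deletes states.\<close>
  then have "T \<subseteq> initial_tableau p0 cs us \<eta>"
    by induction (auto simp: eliminate_def)
  then have state: "tab_state p0 cs us \<eta> D" if "D \<in> T" for D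
    using that by (auto simp: initial_tableau_def)
  have noelim: "\<not> ER1 p0 cs us T D" "\<not> ER2 p0 cs us T D" if "D \<in> T" for D
    using assms(2) that unfolding final_tableau_def eliminate_def by blast+
  have sub: "fst D \<subseteq> tab_formulas p0 \<eta>" if "D \<in> T" for D
    by (rule tab_state_subset(2)[OF assms(1) state[OF that]])
  \<comment> \<open>One finite set contains all labels, so a single schedule serves every
    state.\<close>
  obtain focus where focus: "\<And>\<xi> m. \<xi> \<in> tab_formulas p0 \<eta> \<Longrightarrow> \<exists>n\<ge>(m::nat). focus n = \<xi>"
    using fair_enumeration[OF finite_tab_formulas[of p0 \<eta>]] by blast
  interpret pruned_tableau p0 cs us T D0 focus
  proof
    show "is_listing cs us" by (rule assms(1))
    show "D0 \<in> T" by (rule root_state(1))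
    fix D assume D: "D \<in> T"
    show "finite (fst D)" by (rule finite_subset[OF sub[OF D] finite_tab_formulas])
    show "hintikka p0 D" by (rule tab_state_hintikka[OF state[OF D]])
    show "\<exists>D'. edge p0 cs us T D \<sigma> D'" if "\<sigma> \<in> moves cs us D" for \<sigma>
      using noelim(1)[OF D] that unfolding ER1_def by blast
    show "realized p0 cs us T \<xi> D" if "\<xi> \<in> fst D" "is_gamma \<xi>" for \<xi>
      using noelim(2)[OF D] that unfolding ER2_def by blast
    show "\<exists>n\<ge>m. focus n = \<xi>" if "\<xi> \<in> fst D" for \<xi> m
      using focus subsetD[OF sub[OF D] that] by simp
  qed
  have "sat tab_model \<eta> (to_nat ([] :: ('ag \<Rightarrow> nat) list))"
    using truth(1) root_state(2) root by simp
  then show ?thesis using is_cgm_tab_model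
    by (intro exI[of _ tab_model] exI[of _ "to_nat ([] :: ('ag \<Rightarrow> nat) list)"]) simp
qed

end
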